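(* Let $\mathbf{F}$ be a normed space of continuous functions over a Hausdorff space $X$. Then the following are equivalent: (i) $\mathbf{F}$ is weakly compactly embedded; (ii) $\overline{B_{\mathbf{F}}}^{\mathcal{C}(X)}$ is compact with respect to the pointwise topology on $\mathcal{C}(X)$; (iii) $\widehat{\mathbf{F}}=\left(\mathrm{span}\,\kappa_{\mathbf{F}}(X)\right)^{*}$ as normed spaces, via the bilinear form induced by $\langle x_{\mathbf{F}},f\rangle=f(x)$; that is, each $f\in\widehat{\mathbf{F}}$ induces a bounded linear functional on $\mathrm{span}\,\kappa_{\mathbf{F}}(X)$ (with the norm of $\mathbf{F}^{*}$) determined by $x_{\mathbf{F}}\mapsto f(x)$, $x\in X$, and the resulting correspondence is an isometric isomorphism of $\widehat{\mathbf{F}}$ onto $\left(\mathrm{span}\,\kappa_{\mathbf{F}}(X)\right)^{*}$.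
   Context: All spaces are over $\mathbb{C}$. $\mathcal{C}(X)$ is the space of all continuous functions $X\to\mathbb{C}$ with the compact-open topology. A normed space of continuous functions (NSCF) over $X$ is a linear subspace $\mathbf{F}\subset\mathcal{C}(X)$ equipped with a norm (not necessarily complete) such that the inclusion $J_{\mathbf{F}}:\mathbf{F}\to\mathcal{C}(X)$ is continuous. $B_{\mathbf{F}}$ is its unit ball. $\mathbf{F}$ is weakly compactly embedded if $B_{\mathbf{F}}$ is weakly relatively compact in $\mathcal{C}(X)$ (relatively compact in the weak topology of the locally convex space $\mathcal{C}(X)$). For $x\in X$, $x_{\mathbf{F}}\in\mathbf{F}^{*}$ is the point evaluation $x_{\mathbf{F}}(f)=f(x)$, and $\kappa_{\mathbf{F}}:X\to\mathbf{F}^{*}$ is $\kappa_{\mathbf{F}}(x)=x_{\mathbf{F}}$. $\overline{B_{\mathbf{F}}}^{\mathcal{C}(X)}$ is the closure of $B_{\mathbf{F}}$ in $\mathcal{C}(X)$ (compact-open topology). $\widehat{\mathbf{F}}=\{\alpha f:\alpha>0,\ f\in\overline{B_{\mathbf{F}}}^{\mathcal{C}(X)}\}$, a linear subspace of $\mathcal{C}(X)$ endowed with the norm given by the Minkowski functional of $\overline{B_{\mathbf{F}}}^{\mathcal{C}(X)}$; it is an NSCF over $X$ with closed unit ball $\overline{B_{\mathbf{F}}}^{\mathcal{C}(X)}$. *)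

theory Defs
  imports "HOL-Analysis.Analysis" "HOL-Library.Function_Algebras"
begin

section \<open>Complex vector spaces of functions\<close>

definition cscale :: "complex \<Rightarrow> ('b \<Rightarrow> complex) \<Rightarrow> 'b \<Rightarrow> complex"
  where "cscale c f = (\<lambda>x. c * f x)"

global_interpretation cfun: vector_space "cscale :: complex \<Rightarrow> ('b \<Rightarrow> complex) \<Rightarrow> 'b \<Rightarrow> complex"
proof
  fix a b :: complex and x y :: "'b \<Rightarrow> complex"
  show "cscale a (x + y) = cscale a x + cscale a y"
    by (rule ext) (simp add: cscale_def ring_distribs)
  show "cscale (a + b) x = cscale a x + cscale b x"
    by (rule ext) (simp add: cscale_def ring_distribs)
  show "cscale a (cscale b x) = cscale (a * b) x"
    by (rule ext) (simp add: cscale_def)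
  show "cscale 1 x = x"
    by (rule ext) (simp add: cscale_def)
qed

definition linear_map_on ::
    "(complex \<Rightarrow> 'v \<Rightarrow> 'v::ab_group_add) \<Rightarrow> (complex \<Rightarrow> 'w \<Rightarrow> 'w::ab_group_add) \<Rightarrow> 'v set \<Rightarrow> ('v \<Rightarrow> 'w) \<Rightarrow> bool"
  where "linear_map_on s1 s2 V T \<longleftrightarrow>
    (\<forall>u\<in>V. \<forall>v\<in>V. T (u + v) = T u + T v) \<and> (\<forall>c. \<forall>v\<in>V. T (s1 c v) = s2 c (T v))"


section \<open>Normed spaces of functions, their duals and isometric isomorphisms\<close>

text \<open>A normed space is a pair of a carrier \<open>V\<close> and a function \<open>N\<close>; only the values of
  \<open>N\<close> on \<open>V\<close> matter.\<close>

definition normed_space_on :: "('b \<Rightarrow> complex) set \<Rightarrow> (('b \<Rightarrow> complex) \<Rightarrow> real) \<Rightarrow> bool"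
  where "normed_space_on V N \<longleftrightarrow>
    cfun.subspace V \<and>
    (\<forall>v\<in>V. 0 \<le> N v \<and> (N v = 0 \<longleftrightarrow> v = 0)) \<and>
    (\<forall>c. \<forall>v\<in>V. N (cscale c v) = cmod c * N v) \<and>
    (\<forall>u\<in>V. \<forall>v\<in>V. N (u + v) \<le> N u + N v)"

definition unit_ball :: "('b \<Rightarrow> complex) set \<Rightarrow> (('b \<Rightarrow> complex) \<Rightarrow> real) \<Rightarrow> ('b \<Rightarrow> complex) set"
  where "unit_ball V N = {v \<in> V. N v \<le> 1}"

text \<open>The value 0 off \<open>V\<close> is there because \<^locale>\<open>Metric_space\<close> demands nonnegativity and symmetry
  of the distance on the whole type.\<close>

definition norm_dist :: "('b \<Rightarrow> complex) set \<Rightarrow> (('b \<Rightarrow> complex) \<Rightarrow> real) \<Rightarrow>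
    ('b \<Rightarrow> complex) \<Rightarrow> ('b \<Rightarrow> complex) \<Rightarrow> real"
  where "norm_dist V N u v = (if u \<in> V \<and> v \<in> V then N (u - v) else 0)"

definition norm_topology :: "('b \<Rightarrow> complex) set \<Rightarrow> (('b \<Rightarrow> complex) \<Rightarrow> real) \<Rightarrow> ('b \<Rightarrow> complex) topology"
  where "norm_topology V N = Metric_space.mtopology V (norm_dist V N)"

lemma Metric_space_norm_dist:
  assumes "normed_space_on V N"
  shows "Metric_space V (norm_dist V N)"
proof -
  have V: "cfun.subspace V"
    and nonneg: "\<And>v. v \<in> V \<Longrightarrow> 0 \<le> N v"
    and zero: "\<And>v. v \<in> V \<Longrightarrow> N v = 0 \<longleftrightarrow> v = 0"
    and scale: "\<And>c v. v \<in> V \<Longrightarrow> N (cscale c v) = cmod c * N v"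
    and triangle: "\<And>u v. u \<in> V \<Longrightarrow> v \<in> V \<Longrightarrow> N (u + v) \<le> N u + N v"
    using assms by (simp_all add: normed_space_on_def)
  note sub = cfun.subspace_diff[OF V]
  have comm: "N (u - v) = N (v - u)" if "u \<in> V" "v \<in> V" for u v
  proof -
    have "cscale (- 1) (v - u) = u - v"
      by (rule ext) (simp add: cscale_def)
    then show ?thesis
      using scale[OF sub[OF that(2,1)], of "- 1"] by simp
  qed
  show ?thesis
  proof (rule Metric_space.intro)
    show "0 \<le> norm_dist V N u v" for u v
      unfolding norm_dist_def using nonneg[OF sub[of u v]] by simp
    show "norm_dist V N u v = norm_dist V N v u" for u v
      unfolding norm_dist_def using comm[of u v] by simp
    show "norm_dist V N u v = 0 \<longleftrightarrow> u = v" if "u \<in> V" "v \<in> V" for u v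
      unfolding norm_dist_def using that zero[OF sub[OF that]] right_minus_eq[of u v] by presburger
    show "norm_dist V N u w \<le> norm_dist V N u v + norm_dist V N v w"
      if "u \<in> V" "v \<in> V" "w \<in> V" for u v w
    proof -
      have "(u - v) + (v - w) = u - w"
        by (rule ext) simp
      then show ?thesis
        unfolding norm_dist_def
        using triangle[OF sub[OF that(1,2)] sub[OF that(2,3)]] that by presburger
    qed
  qed
qed

text \<open>Functionals on \<open>V\<close> are represented by total functions that vanish off \<open>V\<close>. Thus equality of
  functionals is equality of functions, and the dual is again a space of complex-valued functions.\<close>

definition dual_space :: "('b \<Rightarrow> complex) set \<Rightarrow> (('b \<Rightarrow> complex) \<Rightarrow> real) \<Rightarrow> (('b \<Rightarrow> complex) \<Rightarrow> complex) set"
  where "dual_space V N = {\<phi>. linear_map_on cscale (*) V \<phi> \<and>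
    (\<exists>C. \<forall>v\<in>V. cmod (\<phi> v) \<le> C * N v) \<and> (\<forall>v. v \<notin> V \<longrightarrow> \<phi> v = 0)}"

definition dual_norm :: "('b \<Rightarrow> complex) set \<Rightarrow> (('b \<Rightarrow> complex) \<Rightarrow> real) \<Rightarrow> (('b \<Rightarrow> complex) \<Rightarrow> complex) \<Rightarrow> real"
  where "dual_norm V N \<phi> = (SUP v\<in>unit_ball V N. cmod (\<phi> v))"

definition isometric_isomorphism ::
    "('b \<Rightarrow> complex) set \<Rightarrow> (('b \<Rightarrow> complex) \<Rightarrow> real) \<Rightarrow> ('c \<Rightarrow> complex) set \<Rightarrow> (('c \<Rightarrow> complex) \<Rightarrow> real) \<Rightarrow>
     (('b \<Rightarrow> complex) \<Rightarrow> ('c \<Rightarrow> complex)) \<Rightarrow> bool"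
  where "isometric_isomorphism V N W M T \<longleftrightarrow>
    linear_map_on cscale cscale V T \<and> bij_betw T V W \<and> (\<forall>v\<in>V. M (T v) = N v)"

definition minkowski :: "('b \<Rightarrow> complex) set \<Rightarrow> ('b \<Rightarrow> complex) \<Rightarrow> real"
  where "minkowski A f = Inf {t. 0 < t \<and> f \<in> cscale (complex_of_real t) ` A}"


section \<open>The space of continuous functions and its topologies\<close>

definition Cfuns :: "('a::topological_space \<Rightarrow> complex) set"
  where "Cfuns = {f. continuous_on UNIV f}"

definition compact_open :: "('a::topological_space \<Rightarrow> complex) topology"
  where "compact_open = topology_generated_by
    {{f \<in> Cfuns. f ` K \<subseteq> U} | K U. compact K \<and> open U}"

definition pointwise :: "('a::topological_space \<Rightarrow> complex) topology"
  where "pointwise = subtopology (product_topology (\<lambda>_. euclidean) UNIV) Cfuns"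

definition Cfuns_dual :: "(('a::topological_space \<Rightarrow> complex) \<Rightarrow> complex) set"
  where "Cfuns_dual = {\<phi>. linear_map_on cscale (*) Cfuns \<phi> \<and> continuous_map compact_open euclidean \<phi>}"

definition weak_Cfuns :: "('a::topological_space \<Rightarrow> complex) topology"
  where "weak_Cfuns = topology_generated_by
    {{f \<in> Cfuns. \<phi> f \<in> U} | \<phi> U. \<phi> \<in> Cfuns_dual \<and> open U}"


section \<open>Normed spaces of continuous functions\<close>

definition nscf :: "('a::topological_space \<Rightarrow> complex) set \<Rightarrow> (('a \<Rightarrow> complex) \<Rightarrow> real) \<Rightarrow> bool"
  where "nscf F N \<longleftrightarrow> normed_space_on F N \<and> F \<subseteq> Cfuns \<and>
    continuous_map (norm_topology F N) compact_open (\<lambda>f. f)"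

definition weakly_compactly_embedded ::
    "('a::topological_space \<Rightarrow> complex) set \<Rightarrow> (('a \<Rightarrow> complex) \<Rightarrow> real) \<Rightarrow> bool"
  where "weakly_compactly_embedded F N \<longleftrightarrow> compactin weak_Cfuns (weak_Cfuns closure_of unit_ball F N)"

definition ball_closure ::
    "('a::topological_space \<Rightarrow> complex) set \<Rightarrow> (('a \<Rightarrow> complex) \<Rightarrow> real) \<Rightarrow> ('a \<Rightarrow> complex) set"
  where "ball_closure F N = compact_open closure_of unit_ball F N"

definition hat :: "('a::topological_space \<Rightarrow> complex) set \<Rightarrow> (('a \<Rightarrow> complex) \<Rightarrow> real) \<Rightarrow> ('a \<Rightarrow> complex) set"
  where "hat F N = {cscale (complex_of_real \<alpha>) f | \<alpha> f. 0 < \<alpha> \<and> f \<in> ball_closure F N}"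

definition hat_norm ::
    "('a::topological_space \<Rightarrow> complex) set \<Rightarrow> (('a \<Rightarrow> complex) \<Rightarrow> real) \<Rightarrow> ('a \<Rightarrow> complex) \<Rightarrow> real"
  where "hat_norm F N = minkowski (ball_closure F N)"

definition point_eval :: "('a \<Rightarrow> complex) set \<Rightarrow> 'a \<Rightarrow> ('a \<Rightarrow> complex) \<Rightarrow> complex"
  where "point_eval F x = (\<lambda>f. if f \<in> F then f x else 0)"

definition eval_span :: "('a \<Rightarrow> complex) set \<Rightarrow> (('a \<Rightarrow> complex) \<Rightarrow> complex) set"
  where "eval_span F = cfun.span (range (point_eval F))"

end

theory Submission
  imports Defs
begin

text \<open>Write \<open>B\<close> for the unit ball of \<open>F\<close>, \<open>A\<close> for its closure in the compact-open topology, and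
\<open>P = closure B\<close> for its closure in the product topology of all functions; always \<open>A \<subseteq> P\<close>. Continuity
of the inclusion bounds \<open>B\<close> uniformly on each compact set, so \<open>P\<close> is compact by Tychonoff's theorem,
and \<open>A\<close> is pointwise compact exactly when \<open>A = P\<close>. Both equivalences are about this equality.

Weak against pointwise compactness rests on one fact, \<open>convex_pointwise_closure_uniform\<close>: inside a
pointwise compact set of continuous functions that is bounded on the compact set \<open>K\<close>, a function in the
pointwise closure of a convex set \<open>S\<close> is approximated by members of \<open>S\<close> uniformly on \<open>K\<close>. It splits
into a passage from closures to sequences (\<open>pointwise_closure_sequence\<close>, the Eberlein--Grothendieck
argument) and a passage from pointwise convergent sequences to uniformly convergent convex combinations
(\<open>collapsing_convex_sets_uniformly_small\<close>, Simons' argument). If the weak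
closure of \<open>B\<close> is compact, the fact with \<open>S = B\<close> puts that closure into \<open>A\<close>.
Conversely, if \<open>A\<close> is pointwise compact, the fact with \<open>S = {f \<in> A. t \<le> Re (c * \<phi> f)}\<close> makes this set
pointwise closed in \<open>A\<close>, so every continuous functional \<open>\<phi>\<close> is pointwise continuous on \<open>A\<close>; hence the
weak topology of \<open>A\<close> is coarser than its pointwise topology, and \<open>A\<close> is weakly compact.

For the duality, a multiple \<open>g\<close> of a member of \<open>P\<close> defines a functional \<open>induced F g\<close> on the span of the
evaluations, because an estimate of a finite combination of point values on \<open>B\<close> persists on \<open>P\<close>. Conversely
every functional of norm at most 1 arises from a member of \<open>P\<close>: by finite-dimensional separation
(\<open>bipolar_pointwise_closure\<close>) \<open>x \<mapsto> \<phi> (point_eval F x)\<close> is a pointwise limit of members of \<open>B\<close>. So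
\<open>P\<close> is the unit ball of the dual, \<open>A\<close> is the unit ball of \<open>hat F N\<close>, and the pairing is an isometric
isomorphism exactly when \<open>A = P\<close>.\<close>

section \<open>From pointwise to uniform smallness\<close>

text \<open>Simons' argument. Suppose that no member of \<open>C 0\<close> is uniformly at most \<open>e\<close>, and let \<open>p\<close> be the supremum
over \<open>K\<close>. Build \<open>z = y 0 / 2 + y 1 / 4 + \<dots>\<close> with \<open>y m \<in> C m\<close> chosen greedily so that
\<open>p (Z m + y m / 2 ^ m)\<close> is almost minimal, where \<open>Z m\<close> is the partial sum. The tail of the series competes
in this choice, so \<open>p (2 * Z (m + 1) - Z m)\<close> hardly exceeds \<open>p z\<close>; by convexity of \<open>p\<close> the gap
\<open>p z - p (Z m)\<close> then at worst about halves in each step and stays above a fixed multiple of \<open>1 / 2 ^ m\<close>.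
At a point \<open>b\<close> where \<open>z\<close> attains its maximum, the tail after \<open>m\<close> is at least this gap, so the values
\<open>y k b\<close> for \<open>k \<ge> m\<close> cannot all be small. Collapse at \<open>b\<close> says that they are.\<close>
lemma collapsing_convex_sets_uniformly_small:
  fixes C :: "nat \<Rightarrow> ('a::topological_space \<Rightarrow> real) set"
  assumes K: "compact K" "K \<noteq> {}"
    and cont: "\<And>m y. y \<in> C m \<Longrightarrow> continuous_on K y"
    and range: "\<And>m y x. y \<in> C m \<Longrightarrow> x \<in> K \<Longrightarrow> 0 \<le> y x \<and> y x \<le> 1"
    and mid: "\<And>m y w. y \<in> C m \<Longrightarrow> w \<in> C m \<Longrightarrow> (\<lambda>x. (y x + w x) / 2) \<in> C m"
    and dec: "\<And>m. C (Suc m) \<subseteq> C m"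
    and nonempty: "\<And>m. C m \<noteq> {}"
    and collapse: "\<And>x e. x \<in> K \<Longrightarrow> 0 < e \<Longrightarrow> \<exists>m. \<forall>y\<in>C m. y x \<le> e"
    and e: "0 < e"
  shows "\<exists>y\<in>C 0. \<forall>x\<in>K. y x \<le> e"
proof (rule ccontr)
  assume contr: "\<not> ?thesis"
  define p where "p g = (SUP x\<in>K. g x)" for g :: "'a \<Rightarrow> real"
  have upper: "g x \<le> p g" if "continuous_on K g" "x \<in> K" for g x
    unfolding p_def using compact_continuous_image[OF that(1) K(1)] that(2)
    by (intro cSUP_upper bounded_imp_bdd_above compact_imp_bounded) auto
  have least: "p g \<le> c" if "\<And>x. x \<in> K \<Longrightarrow> g x \<le> c" for g c
    unfolding p_def using K(2) that by (intro cSUP_least) auto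
  define h :: "nat \<Rightarrow> real" where "h m = (1/2) ^ m" for m
  have h_pos: "0 < h m" for m
    unfolding h_def by simp
  have h_Suc: "h (Suc m) = h m / 2" for m
    unfolding h_def by simp
  \<comment> \<open>The tolerances \<open>e * (h m)\<^sup>2 / 4\<close> are summable even after multiplication by \<open>1 / h m\<close>,
    with sum \<open>e / 2\<close>: they cost only half of the initial gap.\<close>
  have "\<exists>y\<in>C m. \<forall>w\<in>C m. p (\<lambda>x. z x + h m * y x) \<le> p (\<lambda>x. z x + h m * w x) + e * (h m)\<^sup>2 / 4"
    if z: "continuous_on K z" for z m
  proof -
    define P where "P w = p (\<lambda>x. z x + h m * w x)" for w
    obtain x0 where x0: "x0 \<in> K"
      using K by blast
    have "z x0 \<le> P w" if "w \<in> C m" for w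
    proof -
      have "z x0 \<le> z x0 + h m * w x0"
        using range[OF that x0] h_pos[of m] by simp
      also have "\<dots> \<le> P w"
        unfolding P_def using z cont[OF that] x0
        by (intro upper[where g="\<lambda>x. z x + h m * w x"] continuous_intros) auto
      finally show ?thesis .
    qed
    then have bdd: "bdd_below (P ` C m)"
      by (intro bdd_belowI2)
    have "(INF w\<in>C m. P w) < (INF w\<in>C m. P w) + e * (h m)\<^sup>2 / 4"
      using e h_pos[of m] by simp
    then obtain y where "y \<in> C m" "P y < (INF w\<in>C m. P w) + e * (h m)\<^sup>2 / 4"
      using cINF_less_iff[OF nonempty bdd] by blast
    moreover have "(INF w\<in>C m. P w) \<le> P w" if "w \<in> C m" for w
      using bdd that by (intro cINF_lower)
    ultimately show ?thesis
      unfolding P_def by (intro bexI[of _ y]) fastforce+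
  qed
  then obtain sel where sel: "\<And>z m. continuous_on K z \<Longrightarrow> sel z m \<in> C m"
    and sel_min: "\<And>z m w. continuous_on K z \<Longrightarrow> w \<in> C m \<Longrightarrow>
      p (\<lambda>x. z x + h m * sel z m x) \<le> p (\<lambda>x. z x + h m * w x) + e * (h m)\<^sup>2 / 4"
    by metis
  define Z where "Z = rec_nat (\<lambda>x. 0) (\<lambda>m z x. z x + h (Suc m) * sel z m x)"
  define y where "y m = sel (Z m) m" for m
  have Z_0: "Z 0 = (\<lambda>x. 0)"
    unfolding Z_def by simp
  have Z_Suc: "Z (Suc m) = (\<lambda>x. Z m x + h (Suc m) * y m x)" for m
    unfolding Z_def y_def by simp
  have Z_cont: "continuous_on K (Z m)" for m
  proof (induction m)
    case (Suc m)
    then show ?case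
      unfolding Z_Suc y_def using cont[OF sel[OF Suc]] by (intro continuous_intros)
  qed (simp add: Z_0)
  have y: "y m \<in> C m" for m
    unfolding y_def using sel[OF Z_cont] .
  note y_range = range[OF y]
  have Z_sum: "Z m x = (\<Sum>k<m. h (Suc k) * y k x)" for m x
    by (induction m) (simp_all add: Z_0 Z_Suc)
  define z where "z x = (\<Sum>k. h (Suc k) * y k x)" for x
  have summ_h: "summable (\<lambda>k. h (Suc k))"
    unfolding h_def by (simp add: summable_mult)
  have term_le: "norm (h (Suc k) * y k x) \<le> h (Suc k)" if "x \<in> K" for k x
    using y_range[OF that] h_pos[of "Suc k"] by (simp add: abs_mult mult_left_le)
  have unif: "uniform_limit K Z z sequentially"
    unfolding z_def Z_sum[abs_def] using Weierstrass_m_test[OF term_le summ_h] .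
  have z_cont: "continuous_on K z"
    using uniform_limit_theorem[OF _ unif] Z_cont by simp
  have Z_lim: "(\<lambda>m. Z m x) \<longlonglongrightarrow> z x" if "x \<in> K" for x
    using tendsto_uniform_limitI[OF unif that] .
  have Z_le: "Z m x \<le> z x \<and> z x \<le> Z m x + h m * c"
    if x: "x \<in> K" and c: "\<And>k. m \<le> k \<Longrightarrow> y k x \<le> c" for m x c
  proof -
    have step: "Z m x \<le> Z n x \<and> Z n x \<le> Z m x + (h m - h n) * c" if "m \<le> n" for n
      using that
    proof (induction n rule: dec_induct)
      case (step n)
      have "h (Suc n) * y n x \<le> h (Suc n) * c"
        using c[OF step(1)] h_pos[of "Suc n"] by simp
      moreover have "0 \<le> h (Suc n) * y n x"
        using y_range[OF x, of n] h_pos[of "Suc n"] by simp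
      moreover have "(h m - h n) * c + h (Suc n) * c = (h m - h (Suc n)) * c"
        unfolding h_Suc by (simp add: algebra_simps)
      ultimately show ?case
        using step.IH unfolding Z_Suc by linarith
    qed simp
    have "(\<lambda>n. Z m x + (h m - h n) * c) \<longlonglongrightarrow> Z m x + (h m - 0) * c"
      unfolding h_def by (intro tendsto_intros LIMSEQ_power_zero) simp
    then have "z x \<le> Z m x + (h m - 0) * c"
      using LIMSEQ_le[OF Z_lim[OF x]] step by blast
    moreover have "Z m x \<le> z x"
      using LIMSEQ_le_const[OF Z_lim[OF x]] step by blast
    ultimately show ?thesis
      by simp
  qed
  \<comment> \<open>Repeating the last summand replaces the tail of the series by a finite average from \<open>C m\<close>.
    So \<open>V N\<close> below is an admissible competitor at every stage \<open>m \<le> N\<close>, and it tends to \<open>z\<close>.\<close>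
  have reach: "\<exists>w\<in>C m. (\<lambda>x. Z N x + h N * v x) = (\<lambda>x. Z m x + h m * w x)"
    if "m \<le> N" "v \<in> C N" for m N v
    using that
  proof (induction N arbitrary: v rule: dec_induct)
    case (step N)
    have "(\<lambda>x. (y N x + v x) / 2) \<in> C N"
      using step.prems dec[of N] by (intro mid y) auto
    moreover have "(\<lambda>x. Z (Suc N) x + h (Suc N) * v x) = (\<lambda>x. Z N x + h N * ((y N x + v x) / 2))"
      unfolding Z_Suc h_Suc by (simp add: algebra_simps add_divide_distrib)
    ultimately show ?case
      using step.IH by metis
  qed blast
  define V where "V N = (\<lambda>x. Z N x + h N * y N x)" for N
  have V_cont: "continuous_on K (V N)" for N
    unfolding V_def using cont[OF y] Z_cont by (intro continuous_intros)
  have V_le: "p (V N) \<le> p z + h N" for N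
  proof (rule least)
    fix x assume x: "x \<in> K"
    have "h N * y N x \<le> h N"
      using y_range[OF x] h_pos[of N] by (simp add: mult_left_le)
    moreover have "Z N x \<le> z x"
      using Z_le[OF x, of N 1] y_range[OF x] by blast
    ultimately show "V N x \<le> p z + h N"
      unfolding V_def using upper[OF z_cont x] by linarith
  qed
  have h_lim: "(\<lambda>N. c + h N) \<longlonglongrightarrow> c" for c
    using tendsto_add[OF tendsto_const LIMSEQ_power_zero[of "1/2::real"], of c]
    unfolding h_def by simp
  have pz: "e \<le> p z"
  proof (rule LIMSEQ_le_const[OF h_lim], intro exI allI impI)
    fix N :: nat
    obtain w where w: "w \<in> C 0" "V N = w"
      using reach[OF _ y, of 0 N] unfolding V_def Z_0 h_def by auto
    then obtain x where x: "x \<in> K" "e < w x"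
      using contr by (metis not_le)
    have "w x \<le> p w"
      using upper[OF cont[OF w(1)] x(1)] .
    then show "e \<le> p z + h N"
      using V_le[of N] x(2) unfolding w(2) by linarith
  qed
  have over: "p (V m) \<le> p z + e * (h m)\<^sup>2 / 4" for m
  proof (rule LIMSEQ_le_const[OF h_lim], intro exI allI impI)
    fix N assume "m \<le> N"
    then obtain w where w: "w \<in> C m" "V N = (\<lambda>x. Z m x + h m * w x)"
      using reach[OF _ y, of m N] unfolding V_def by auto
    have "p (V m) \<le> p (V N) + e * (h m)\<^sup>2 / 4"
      using sel_min[OF Z_cont[of m] w(1)] unfolding w(2) unfolding V_def y_def .
    then show "p (V m) \<le> p z + e * (h m)\<^sup>2 / 4 + h N"
      using V_le[of N] by linarith
  qed
  \<comment> \<open>Of the scaled gap, half of \<open>e\<close> is kept forever; the other half, of which \<open>e / 2 * h m\<close>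
    is left at stage \<open>m\<close>, pays for the tolerances.\<close>
  have gap: "h m * (e / 2) * (1 + h m) \<le> p z - p (Z m)" for m
  proof (induction m)
    case 0
    have "p (Z 0) \<le> 0"
      by (rule least) (simp add: Z_0)
    then show ?case
      using pz by (simp add: h_def)
  next
    case (Suc m)
    have "p (Z (Suc m)) \<le> (p (V m) + p (Z m)) / 2"
    proof (rule least)
      fix x assume x: "x \<in> K"
      have "Z (Suc m) x = (V m x + Z m x) / 2"
        unfolding Z_Suc V_def h_Suc by (simp add: algebra_simps)
      then show "Z (Suc m) x \<le> (p (V m) + p (Z m)) / 2"
        using upper[OF V_cont x, of m] upper[OF Z_cont x, of m] by simp
    qed
    moreover have "h (Suc m) * (e / 2) * (1 + h (Suc m)) =
        (h m * (e / 2) * (1 + h m) - e * (h m)\<^sup>2 / 4) / 2"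
      unfolding h_Suc by (simp add: field_simps power2_eq_square)
    ultimately show ?case
      using Suc.IH over[of m] by (simp add: field_simps)
  qed
  obtain b where b: "b \<in> K" "\<forall>x\<in>K. z x \<le> z b"
    using continuous_attains_sup[OF K z_cont] by blast
  have pzb: "p z \<le> z b"
    using b by (intro least) blast
  obtain m where m: "\<forall>v\<in>C m. v b \<le> e / 4"
    using collapse[OF b(1), of "e / 4"] e by auto
  have "C k \<subseteq> C m" if "m \<le> k" for k
    using lift_Suc_antimono_le[of C, OF dec that] .
  then have "y k b \<le> e / 4" if "m \<le> k" for k
    using that m y[of k] by blast
  then have "z b \<le> Z m b + h m * (e / 4)"
    using Z_le[OF b(1)] by blast
  then have "h m * (e / 2) * (1 + h m) \<le> h m * (e / 4)"
    using gap[of m] pzb upper[OF Z_cont b(1), of m] by linarith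
  moreover have "h m * (e / 4) < h m * (e / 2) * (1 + h m)"
    using e h_pos[of m] by (simp add: field_simps add_pos_pos)
  ultimately show False
    by linarith
qed

text \<open>The combination is written with \<^const>\<open>cscale\<close> so that complex-linear functionals apply to it directly.\<close>
definition convex_funs :: "('a \<Rightarrow> complex) set \<Rightarrow> bool"
  where "convex_funs S \<longleftrightarrow> (\<forall>f\<in>S. \<forall>g\<in>S. \<forall>t\<in>{0..1}.
    cscale (complex_of_real (1 - t)) f + cscale (complex_of_real t) g \<in> S)"

text \<open>Simons' argument needs real functions with values in \<open>[0, 1]\<close>. It is applied to the rescaled majorants of
\<open>\<bar>g - f0\<bar>\<close>, \<open>g \<in> S\<close>, that at each point are dominated by every common bound of the tail
\<open>\<bar>f j - f0\<bar>\<close>, \<open>j \<ge> m\<close>; averaging two such majorants averages the corresponding members of \<open>S\<close>.\<close>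
lemma convex_pointwise_limit_uniform:
  fixes f :: "nat \<Rightarrow> 'a::topological_space \<Rightarrow> complex"
  assumes K: "compact K" and S: "convex_funs S" and fS: "\<And>n. f n \<in> S"
    and cont: "\<And>n. continuous_on K (f n)" "continuous_on K f0"
    and bound: "\<And>n x. x \<in> K \<Longrightarrow> cmod (f n x - f0 x) \<le> M"
    and lim: "\<And>x. x \<in> K \<Longrightarrow> (\<lambda>n. f n x) \<longlonglongrightarrow> f0 x"
    and e: "0 < e"
  shows "\<exists>g\<in>S. \<forall>x\<in>K. cmod (g x - f0 x) \<le> e"
proof (cases "K = {}")
  case True
  then show ?thesis
    using fS by blast
next
  case False
  define L where "L = max M 1"
  have L: "0 < L" "M \<le> L"
    unfolding L_def by auto
  define C where "C m = {y :: 'a \<Rightarrow> real. continuous_on K y \<and> (\<forall>x\<in>K. 0 \<le> y x) \<and>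
      (\<forall>x\<in>K. \<forall>c. (\<forall>j\<ge>m. cmod (f j x - f0 x) \<le> L * c) \<longrightarrow> y x \<le> c) \<and>
      (\<exists>g\<in>S. \<forall>x\<in>K. cmod (g x - f0 x) \<le> L * y x)}" for m
  have "\<exists>y\<in>C 0. \<forall>x\<in>K. y x \<le> e / L"
  proof (rule collapsing_convex_sets_uniformly_small[OF K False])
    show "continuous_on K y" if "y \<in> C m" for m y
      using that unfolding C_def by blast
    show "0 \<le> y x \<and> y x \<le> 1" if "y \<in> C m" "x \<in> K" for m y x
    proof -
      have "\<forall>j\<ge>m. cmod (f j x - f0 x) \<le> L * 1"
        using bound[OF that(2)] L by (metis mult_1_right order_trans)
      then show ?thesis
        using that unfolding C_def by blast
    qed
    show "(\<lambda>x. (y x + w x) / 2) \<in> C m" if y: "y \<in> C m" and w: "w \<in> C m" for m y w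
    proof -
      obtain g where g: "g \<in> S" "\<forall>x\<in>K. cmod (g x - f0 x) \<le> L * y x"
        using y unfolding C_def by blast
      obtain g' where g': "g' \<in> S" "\<forall>x\<in>K. cmod (g' x - f0 x) \<le> L * w x"
        using w unfolding C_def by blast
      define k where "k = cscale (complex_of_real (1 - 1/2)) g + cscale (complex_of_real (1/2)) g'"
      have "k \<in> S"
        using S g g' unfolding convex_funs_def k_def by fastforce
      moreover have "cmod (k x - f0 x) \<le> L * ((y x + w x) / 2)" if x: "x \<in> K" for x
      proof -
        have "k x - f0 x = ((g x - f0 x) + (g' x - f0 x)) / 2"
          unfolding k_def cscale_def by (simp add: field_simps)
        also have "cmod \<dots> \<le> (cmod (g x - f0 x) + cmod (g' x - f0 x)) / 2"
          using norm_triangle_ineq[of "g x - f0 x" "g' x - f0 x"] by (simp only: norm_divide) simp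
        also have "\<dots> \<le> (L * y x + L * w x) / 2"
          using g(2) g'(2) x by (simp add: add_mono)
        finally show ?thesis
          by (simp add: algebra_simps)
      qed
      moreover have "continuous_on K (\<lambda>x. (y x + w x) / 2)"
        using y w unfolding C_def by (auto intro!: continuous_intros)
      moreover have "(y x + w x) / 2 \<le> c" 
        if "x \<in> K" "\<forall>j\<ge>m. cmod (f j x - f0 x) \<le> L * c" for x c
      proof -
        have "y x \<le> c" "w x \<le> c"
          using y w that unfolding C_def by blast+
        then show ?thesis by simp
      qed
      moreover have "0 \<le> (y x + w x) / 2" if "x \<in> K" for x
        using y w that unfolding C_def by fastforce
      ultimately show ?thesis
        unfolding C_def by blast
    qed
    show "C (Suc m) \<subseteq> C m" for m
      unfolding C_def by (auto dest: Suc_leD)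
    show "C m \<noteq> {}" for m
    proof -
      have "(\<lambda>x. cmod (f m x - f0 x) / L) \<in> C m"
        unfolding C_def using L fS[of m] cont
        by (auto intro!: continuous_intros bexI[of _ "f m"] simp: field_simps)
      then show ?thesis by blast
    qed
    show "\<exists>m. \<forall>y\<in>C m. y x \<le> d" if x: "x \<in> K" and d: "0 < d" for x d
    proof -
      have "0 < L * d"
        using L d by simp
      then obtain m where "\<forall>j\<ge>m. cmod (f j x - f0 x) < L * d"
        using LIMSEQ_D[OF lim[OF x]] by blast
      then have "\<forall>j\<ge>m. cmod (f j x - f0 x) \<le> L * d"
        by (auto intro: less_imp_le)
      then show ?thesis
        unfolding C_def using x by blast
    qed
    show "0 < e / L"
      using e L by simp
  qed
  then obtain y g where "\<forall>x\<in>K. y x \<le> e / L" "g \<in> S" "\<forall>x\<in>K. cmod (g x - f0 x) \<le> L * y x"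
    unfolding C_def by blast
  then show ?thesis
    using L by (intro bexI[of _ g]) (auto simp: field_simps intro: order_trans)
qed

section \<open>Pointwise closures\<close>

lemma closure_funs_iff:
  fixes S :: "('a \<Rightarrow> complex) set"
  shows "f \<in> closure S \<longleftrightarrow> (\<forall>D e. finite D \<longrightarrow> 0 < e \<longrightarrow> (\<exists>g\<in>S. \<forall>x\<in>D. cmod (g x - f x) < e))"
    (is "?L \<longleftrightarrow> ?R")
proof
  assume L: ?L
  show ?R
  proof (intro allI impI)
    fix D :: "'a set" and e :: real assume D: "finite D" and e: "0 < e"
    have "open (\<Inter>x\<in>D. {g :: 'a \<Rightarrow> complex. cmod (g x - f x) < e})"
      using D by (intro open_INT ballI open_Collect_less continuous_intros) auto
    moreover have "f \<in> (\<Inter>x\<in>D. {g. cmod (g x - f x) < e})"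
      using e by simp
    ultimately have "S \<inter> (\<Inter>x\<in>D. {g. cmod (g x - f x) < e}) \<noteq> {}"
      using L unfolding closure_iff_nhds_not_empty by blast
    then show "\<exists>g\<in>S. \<forall>x\<in>D. cmod (g x - f x) < e"
      by blast
  qed
next
  assume R: ?R
  show ?L
    unfolding closure_iff_nhds_not_empty
  proof (intro allI impI)
    fix A V assume V: "V \<subseteq> A" "open V" "f \<in> V"
    have "openin (product_topology (\<lambda>_. euclidean) UNIV) V"
      using V(2) unfolding open_fun_def .
    from product_topology_open_contains_basis[OF this V(3)]
    obtain X where X: "f \<in> PiE UNIV X" "\<And>i. open (X i)" "finite {i. X i \<noteq> UNIV}" "PiE UNIV X \<subseteq> V"
      unfolding topspace_euclidean open_openin[symmetric] by blast
    have "\<exists>e>0. ball (f i) e \<subseteq> X i" for i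
      using X(1,2) open_contains_ball by (metis PiE_mem UNIV_I)
    then obtain r where r: "\<And>i. 0 < r i" "\<And>i. ball (f i) (r i) \<subseteq> X i"
      by metis
    define e where "e = Min (insert 1 (r ` {i. X i \<noteq> UNIV}))"
    have e: "0 < e" "\<And>i. X i \<noteq> UNIV \<Longrightarrow> e \<le> r i"
      unfolding e_def using X(3) r(1) by (auto simp: Min_gr_iff)
    obtain g where g: "g \<in> S" "\<forall>i\<in>{i. X i \<noteq> UNIV}. cmod (g i - f i) < e"
      using R X(3) e(1) by blast
    have "g i \<in> X i" for i
    proof (cases "X i = UNIV")
      case False
      then have "g i \<in> ball (f i) (r i)"
        using g(2) e(2)[of i] by (auto simp: dist_norm norm_minus_commute)
      then show ?thesis
        using r(2) by blast
    qed simp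
    then have "g \<in> V"
      using X(4) by (auto simp: PiE_def)
    then show "S \<inter> A \<noteq> {}"
      using g(1) V(1) by blast
  qed
qed

lemma convex_funs_closure:
  fixes S :: "('a \<Rightarrow> complex) set"
  assumes "convex_funs S"
  shows "convex_funs (closure S)"
  unfolding convex_funs_def
proof (intro ballI)
  fix f g and t :: real assume f: "f \<in> closure S" and g: "g \<in> closure S" and t: "t \<in> {0..1}"
  let ?k = "\<lambda>f g. cscale (complex_of_real (1 - t)) f + cscale (complex_of_real t) g"
  show "?k f g \<in> closure S"
    unfolding closure_funs_iff
  proof (intro allI impI)
    fix D :: "'a set" and e :: real assume D: "finite D" "0 < e"
    obtain f' where f': "f' \<in> S" "\<forall>x\<in>D. cmod (f' x - f x) < e"
      using f D unfolding closure_funs_iff by blast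
    obtain g' where g': "g' \<in> S" "\<forall>x\<in>D. cmod (g' x - g x) < e"
      using g D unfolding closure_funs_iff by blast
    have "cmod (?k f' g' x - ?k f g x) < e" if "x \<in> D" for x
    proof -
      have "?k f' g' x - ?k f g x = complex_of_real (1 - t) * (f' x - f x) + complex_of_real t * (g' x - g x)"
        by (simp add: cscale_def algebra_simps)
      also have "cmod \<dots> \<le> (1 - t) * cmod (f' x - f x) + t * cmod (g' x - g x)"
        using t by (intro norm_triangle_le) (simp only: norm_mult norm_of_real, simp)
      also have "\<dots> < e"
        using f'(2) g'(2) that t by (intro convex_bound_lt) auto
      finally show ?thesis .
    qed
    moreover have "?k f' g' \<in> S"
      using assms f'(1) g'(1) t unfolding convex_funs_def by blast
    ultimately show "\<exists>h\<in>S. \<forall>x\<in>D. cmod (h x - ?k f g x) < e"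
      by blast
  qed
qed

lemma compact_funs_imp_closed:
  fixes A :: "('a \<Rightarrow> complex) set"
  assumes "compact A"
  shows "closed A"
proof -
  have "Hausdorff_space (product_topology (\<lambda>_ :: 'a. euclidean :: complex topology) UNIV)"
    by (simp add: Hausdorff_space_product_topology)
  then have "Hausdorff_space (euclidean :: ('a \<Rightarrow> complex) topology)"
    unfolding euclidean_product_topology .
  from compactin_imp_closedin[OF this, of A] show ?thesis
    using assms unfolding compactin_euclidean_iff closed_closedin[symmetric] .
qed

section \<open>Countable approximation in pointwise compact sets\<close>

text \<open>Compactness without first countability gives no convergent subsequence, only a cluster point. That is enough
whenever the values of the test functions along the sequence are already known to converge.\<close>
lemma compact_cluster_value:
  fixes d :: "nat \<Rightarrow> 'x::topological_space"
  assumes K: "compact K" and d: "\<And>n. d n \<in> K"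
  obtains y where "y \<in> K" and
    "\<And>(q :: 'x \<Rightarrow> 'y::t2_space) c. continuous_on UNIV q \<Longrightarrow> (\<lambda>n. q (d n)) \<longlonglongrightarrow> c \<Longrightarrow> q y = c"
proof -
  have "filtermap d sequentially \<noteq> bot" "eventually (\<lambda>x. x \<in> K) (filtermap d sequentially)"
    using d by (simp_all add: filtermap_bot_iff eventually_filtermap)
  then obtain y where y: "y \<in> K" "inf (nhds y) (filtermap d sequentially) \<noteq> bot"
    using K unfolding compact_filter by blast
  have "q y = c" if q: "continuous_on UNIV q" and c: "(\<lambda>n. q (d n)) \<longlonglongrightarrow> c" for q :: "'x \<Rightarrow> 'y" and c
  proof (rule tendsto_unique[OF y(2)])
    have "(q \<longlongrightarrow> q y) (nhds y)"
      using q by (simp add: continuous_on_def flip: tendsto_at_iff_tendsto_nhds)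
    then show "(q \<longlongrightarrow> q y) (inf (nhds y) (filtermap d sequentially))"
      by (rule tendsto_mono[OF inf_le1])
    have "(q \<longlongrightarrow> c) (filtermap d sequentially)"
      using c unfolding filterlim_def filtermap_filtermap by simp
    then show "(q \<longlongrightarrow> c) (inf (nhds y) (filtermap d sequentially))"
      by (rule tendsto_mono[OF inf_le2])
  qed
  then show thesis
    using that y(1) by blast
qed

lemma finite_net_for_functions:
  fixes G :: "('a::topological_space \<Rightarrow> complex) set"
  assumes K: "compact K" and G: "finite G" "G \<subseteq> Cfuns" and e: "0 < e"
  shows "\<exists>D. finite D \<and> D \<subseteq> K \<and> (\<forall>x\<in>K. \<exists>d\<in>D. \<forall>q\<in>G. cmod (q d - q x) < e)"
proof -
  define U where "U d = (\<Inter>q\<in>G. {x. cmod (q d - q x) < e})" for d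
  have "open (U d)" for d
    unfolding U_def using G
    by (intro open_INT ballI open_Collect_less continuous_intros) (auto simp: Cfuns_def)
  moreover have "K \<subseteq> (\<Union>d\<in>K. U d)"
    unfolding U_def using e by auto
  ultimately obtain D where "D \<subseteq> K" "finite D" "K \<subseteq> (\<Union>d\<in>D. U d)"
    using compactE_image[OF K] by metis
  then show ?thesis
    unfolding U_def by (intro exI[of _ D]) blast
qed

text \<open>The Eberlein--Grothendieck argument. Starting from \<open>f0\<close>, pick members of \<open>S\<close> and finite subsets of \<open>K\<close> alternately: each new
finite set approximates, in the values of all functions picked so far, every point of \<open>K\<close>; each new
function is close to \<open>f0\<close> on all finite sets so far. Let \<open>g \<in> A\<close> be a cluster point of the functions,
and \<open>x \<in> K\<close>. Points of the finite sets that approximate \<open>x\<close> cluster at some \<open>y \<in> K\<close>, which none of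
the picked functions, hence neither \<open>f0\<close> nor \<open>g\<close>, separates from \<open>x\<close>. As \<open>g\<close> and \<open>f0\<close> are
continuous and agree on the finite sets, they agree at \<open>y\<close>, so also at \<open>x\<close>. Every cluster point being
\<open>f0\<close> on \<open>K\<close>, the sequence converges to \<open>f0\<close> there.\<close>
lemma pointwise_closure_sequence:
  fixes A :: "('a::topological_space \<Rightarrow> complex) set"
  assumes K: "compact K" and A: "compact A" "A \<subseteq> Cfuns" and S: "S \<subseteq> A"
    and f0: "f0 \<in> A" "f0 \<in> closure S"
  obtains f where "\<And>n. f n \<in> S" and "\<And>x. x \<in> K \<Longrightarrow> (\<lambda>n. f n x) \<longlonglongrightarrow> f0 x"
proof -
  \<comment> \<open>A state is the pair of the functions and the points collected so far.\<close>
  define P where "P n GD = (case GD of (G, D) \<Rightarrow>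
      finite G \<and> f0 \<in> G \<and> G \<subseteq> A \<and> finite D \<and> D \<subseteq> K)"
    for n :: nat and GD :: "('a \<Rightarrow> complex) set \<times> 'a set"
  define Q where "Q n GD GD' = (case GD of (G, D) \<Rightarrow> case GD' of (G', D') \<Rightarrow>
      G \<subseteq> G' \<and> D \<subseteq> D' \<and>
      (\<forall>x\<in>K. \<exists>d\<in>D'. \<forall>q\<in>G. cmod (q d - q x) < inverse (real (Suc n))) \<and>
      (\<exists>f\<in>G' \<inter> S. \<forall>d\<in>D'. cmod (f d - f0 d) < inverse (real (Suc n))))"
    for n :: nat and GD GD' :: "('a \<Rightarrow> complex) set \<times> 'a set"
  have "\<exists>GD'. P (Suc n) GD' \<and> Q n GD GD'" if GD: "P n GD" for n GD
  proof -
    obtain G D where GD_eq: "GD = (G, D)"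
      by fastforce
    then have G: "finite G" "f0 \<in> G" "G \<subseteq> A" "finite D" "D \<subseteq> K"
      using GD unfolding P_def by auto
    obtain D1 where D1: "finite D1" "D1 \<subseteq> K"
        "\<forall>x\<in>K. \<exists>d\<in>D1. \<forall>q\<in>G. cmod (q d - q x) < inverse (real (Suc n))"
      using finite_net_for_functions[OF K G(1), of "inverse (real (Suc n))"] G(3) A(2)
      by (metis inverse_positive_iff_positive of_nat_0_less_iff order_trans zero_less_Suc)
    obtain f where f: "f \<in> S" "\<forall>d\<in>D \<union> D1. cmod (f d - f0 d) < inverse (real (Suc n))"
      using f0(2)[unfolded closure_funs_iff, rule_format, of "D \<union> D1" "inverse (real (Suc n))"] G(4) D1(1)
      by auto
    have "P (Suc n) (insert f G, D \<union> D1)"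
      unfolding P_def using G D1 f S by auto
    moreover have "Q n GD (insert f G, D \<union> D1)"
      unfolding Q_def GD_eq prod.case
    proof (intro conjI)
      show "\<forall>x\<in>K. \<exists>d\<in>D \<union> D1. \<forall>q\<in>G. cmod (q d - q x) < inverse (real (Suc n))"
        using D1(3) by (meson UnI2)
      show "\<exists>f\<in>insert f G \<inter> S. \<forall>d\<in>D \<union> D1. cmod (f d - f0 d) < inverse (real (Suc n))"
        using f by (intro bexI[of _ f]) simp_all
    qed auto
    ultimately show ?thesis
      by blast
  qed
  moreover have "P 0 ({f0}, {})"
    unfolding P_def using f0 by simp
  ultimately obtain GD where GD: "\<And>n. P n (GD n)" "\<And>n. Q n (GD n) (GD (Suc n))"
    using dependent_nat_choice[of P Q] by metis
  define G where "G n = fst (GD n)" for n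
  define D where "D n = snd (GD n)" for n
  have G: "f0 \<in> G n" "G n \<subseteq> A" "D n \<subseteq> K" for n
    using GD(1)[of n] unfolding P_def G_def D_def by (auto split: prod.splits)
  have mono: "G n \<subseteq> G (Suc n)" "D n \<subseteq> D (Suc n)" for n
    using GD(2)[of n] unfolding Q_def G_def D_def by (auto split: prod.splits)
  have net: "\<exists>d\<in>D (Suc n). \<forall>q\<in>G n. cmod (q d - q x) < inverse (real (Suc n))" if "x \<in> K" for n x
    using GD(2)[of n] that unfolding Q_def G_def D_def by (auto split: prod.splits)
  have "\<exists>f\<in>G (Suc n) \<inter> S. \<forall>d\<in>D (Suc n). cmod (f d - f0 d) < inverse (real (Suc n))" for n
    using GD(2)[of n] unfolding Q_def G_def D_def by (auto split: prod.splits)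
  then obtain f where f: "\<And>n. f n \<in> G (Suc n)" "\<And>n. f n \<in> S"
    and f_near: "\<And>n d. d \<in> D (Suc n) \<Longrightarrow> cmod (f n d - f0 d) < inverse (real (Suc n))"
    by (metis IntD1 IntD2)
  have G_mono: "G m \<subseteq> G n" and D_mono: "D m \<subseteq> D n" if "m \<le> n" for m n
    using lift_Suc_mono_le[of G, OF mono(1) that] lift_Suc_mono_le[of D, OF mono(2) that] by auto
  have squeeze: "u \<longlonglongrightarrow> c" if "\<And>n. m \<le> n \<Longrightarrow> cmod (u n - c) < inverse (real (Suc n))"
    for u :: "nat \<Rightarrow> complex" and c m
  proof -
    have "eventually (\<lambda>n. norm (u n - c) \<le> inverse (real (Suc n))) sequentially"
      using that by (intro eventually_sequentiallyI[of m]) (auto intro: less_imp_le)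
    then have "(\<lambda>n. u n - c) \<longlonglongrightarrow> 0"
      by (rule Lim_null_comparison[OF _ LIMSEQ_inverse_real_of_nat])
    then show ?thesis
      by (simp add: LIM_zero_cancel)
  qed
  have D_lim: "(\<lambda>n. f n d) \<longlonglongrightarrow> f0 d" if "d \<in> D m" for d m
    using f_near D_mono that by (intro squeeze[of m]) (meson le_SucI subsetD)
  have "(\<lambda>n. f n x) \<longlonglongrightarrow> f0 x" if x: "x \<in> K" for x
  proof (rule ccontr)
    assume "\<not> (\<lambda>n. f n x) \<longlonglongrightarrow> f0 x"
    then obtain \<eta> where \<eta>: "0 < \<eta>" "\<And>m. \<exists>n\<ge>m. \<eta> \<le> cmod (f n x - f0 x)"
      unfolding LIMSEQ_iff by (meson not_le)
    obtain r :: "nat \<Rightarrow> nat" where r: "strict_mono r" "\<And>n. \<eta> \<le> cmod (f (r n) x - f0 x)"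
      using infinite_enumerate[of "{n. \<eta> \<le> cmod (f n x - f0 x)}"] \<eta>(2)
      unfolding infinite_nat_iff_unbounded_le by auto
    obtain g where g: "g \<in> A" and g_val: "\<And>(q :: ('a \<Rightarrow> complex) \<Rightarrow> complex) c.
        continuous_on UNIV q \<Longrightarrow> (\<lambda>n. q (f (r n))) \<longlonglongrightarrow> c \<Longrightarrow> q g = c"
      using compact_cluster_value[OF A(1), of "\<lambda>n. f (r n)"] f(2) S by blast
    have g_D: "g d = f0 d" if "d \<in> D m" for d m
      using g_val[of "\<lambda>h. h d" "f0 d"] LIMSEQ_subseq_LIMSEQ[OF D_lim[OF that] r(1)]
      by (simp add: comp_def continuous_on_product_coordinates)
    obtain d where d: "\<And>n. d n \<in> D (Suc n)"
      and d_near: "\<And>n q. q \<in> G n \<Longrightarrow> cmod (q (d n) - q x) < inverse (real (Suc n))"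
      using net[OF x] by metis
    obtain y where "y \<in> K" and y_val: "\<And>(q :: 'a \<Rightarrow> complex) c.
        continuous_on UNIV q \<Longrightarrow> (\<lambda>n. q (d n)) \<longlonglongrightarrow> c \<Longrightarrow> q y = c"
      using compact_cluster_value[OF K, of d] d G(3) by blast
    have y_G: "q y = q x" if "q \<in> G m" for q m
    proof (rule y_val)
      show "continuous_on UNIV q"
        using that G(2) A(2) unfolding Cfuns_def by blast
      show "(\<lambda>n. q (d n)) \<longlonglongrightarrow> q x"
        using that d_near G_mono by (intro squeeze[of m]) blast
    qed
    have "g y - f0 y = 0"
      using g f0(1) A(2) g_D[OF d] unfolding Cfuns_def
      by (intro y_val[of "\<lambda>x. g x - f0 x"] continuous_intros) auto
    moreover have "g x - g y = 0"
      using y_G[OF f(1)]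
      by (intro g_val[of "\<lambda>h. h x - h y"] continuous_intros) auto
    moreover have "f0 y = f0 x"
      using y_G[OF G(1)] .
    ultimately have "g x = f0 x"
      by simp
    \<comment> \<open>The truncation at \<open>\<eta>\<close> makes the values along the subsequence constant, hence convergent.\<close>
    moreover have "complex_of_real (min (cmod (g x - f0 x)) \<eta>) = complex_of_real \<eta>"
    proof (rule g_val[of "\<lambda>h. complex_of_real (min (cmod (h x - f0 x)) \<eta>)"])
      show "(\<lambda>n. complex_of_real (min (cmod (f (r n) x - f0 x)) \<eta>)) \<longlonglongrightarrow> complex_of_real \<eta>"
        using r(2) by (simp add: min_absorb2)
    qed (auto intro!: continuous_intros)
    ultimately show False
      using \<eta>(1) by simp
  qed
  then show thesis
    using that f(2) by blast
qed

text \<open>A substitute for Mazur's theorem in which the hypothesis is membership in the pointwise closure only.\<close>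
lemma convex_pointwise_closure_uniform:
  fixes A :: "('a::topological_space \<Rightarrow> complex) set"
  assumes K: "compact K" and A: "compact A" "A \<subseteq> Cfuns"
    and bound: "\<And>f x. f \<in> A \<Longrightarrow> x \<in> K \<Longrightarrow> cmod (f x) \<le> M"
    and S: "S \<subseteq> A" "convex_funs S" and f0: "f0 \<in> A" "f0 \<in> closure S" and e: "0 < e"
  shows "\<exists>g\<in>S. \<forall>x\<in>K. cmod (g x - f0 x) \<le> e"
proof -
  obtain f where f: "\<And>n. f n \<in> S" "\<And>x. x \<in> K \<Longrightarrow> (\<lambda>n. f n x) \<longlonglongrightarrow> f0 x"
    using pointwise_closure_sequence[OF K A S(1) f0] by blast
  have cont: "continuous_on K g" if "g \<in> A" for g
    using that A(2) continuous_on_subset unfolding Cfuns_def by blast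
  have "cmod (f n x - f0 x) \<le> M + M" if "x \<in> K" for n x
    using norm_triangle_ineq4[of "f n x" "f0 x"] bound[OF f0(1) that] bound[of "f n", OF _ that] f(1)[of n] S(1)
    by fastforce
  moreover have "continuous_on K (f n)" for n
    using cont f(1) S(1) by blast
  ultimately show ?thesis
    using convex_pointwise_limit_uniform[OF K S(2) f(1) _ cont[OF f0(1)] _ f(2) e] by blast
qed

section \<open>The three topologies on the continuous functions\<close>

lemma topspace_compact_open [simp]: "topspace compact_open = Cfuns"
proof
  show "Cfuns \<subseteq> topspace (compact_open :: ('a \<Rightarrow> complex) topology)"
    unfolding compact_open_def topology_generated_by_topspace
    by (rule Union_upper) (auto intro!: exI[of _ "{}"])
qed (auto simp: compact_open_def)

lemma topspace_weak_Cfuns [simp]: "topspace weak_Cfuns = Cfuns"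
proof
  have "(\<lambda>f. 0) \<in> Cfuns_dual"
    unfolding Cfuns_dual_def linear_map_on_def by simp
  then show "Cfuns \<subseteq> topspace (weak_Cfuns :: ('a \<Rightarrow> complex) topology)"
    unfolding weak_Cfuns_def topology_generated_by_topspace
    by (intro Union_upper) (auto intro!: exI[of _ "\<lambda>f. 0"] exI[of _ UNIV])
qed (auto simp: weak_Cfuns_def)

lemma compactin_pointwise_iff: "compactin pointwise A \<longleftrightarrow> compact A \<and> A \<subseteq> Cfuns"
  unfolding pointwise_def compactin_subtopology euclidean_product_topology compactin_euclidean_iff ..

text \<open>Uniform closeness on one compact set suffices, because a compact image inside an open set keeps a positive
distance from the complement, and finitely many compact sets have a compact union.\<close>
lemma compact_open_nhd:
  fixes f :: "'a::topological_space \<Rightarrow> complex"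
  assumes "openin compact_open U" "f \<in> U"
  shows "\<exists>K e. compact K \<and> 0 < e \<and> (\<forall>h\<in>Cfuns. (\<forall>x\<in>K. cmod (h x - f x) < e) \<longrightarrow> h \<in> U)"
  using assms unfolding compact_open_def openin_topology_generated_by_iff
proof (induction rule: generate_topology_on.induct)
  case (Int a b)
  obtain K e where K: "compact K" "0 < e" "\<forall>h\<in>Cfuns. (\<forall>x\<in>K. cmod (h x - f x) < e) \<longrightarrow> h \<in> a"
    using Int by auto
  obtain L d where L: "compact L" "0 < d" "\<forall>h\<in>Cfuns. (\<forall>x\<in>L. cmod (h x - f x) < d) \<longrightarrow> h \<in> b"
    using Int by auto
  show ?case
    using K L by (intro exI[of _ "K \<union> L"] exI[of _ "min e d"]) (auto intro: compact_Un)
next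
  case (UN \<U>)
  then obtain V where "V \<in> \<U>" "f \<in> V"
    by blast
  then show ?case
    using UN.IH by (meson Union_iff)
next
  case (Basis s)
  then obtain K V where s: "s = {f \<in> Cfuns. f ` K \<subseteq> V}" "compact K" "open V"
    by blast
  then have f: "f \<in> Cfuns" "f ` K \<subseteq> V"
    using Basis by auto
  have "compact (f ` K)"
    using f(1) s(2) unfolding Cfuns_def
    by (intro compact_continuous_image) (auto intro: continuous_on_subset)
  then obtain e where e: "0 < e" "(\<Union>y\<in>f ` K. ball y e) \<subseteq> V"
    using compact_subset_open_imp_ball_epsilon_subset[OF _ s(3) f(2)] by blast
  have "h \<in> s" if "h \<in> Cfuns" "\<forall>x\<in>K. cmod (h x - f x) < e" for h
  proof -
    have "h x \<in> ball (f x) e" if "x \<in> K" for x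
      using \<open>\<forall>x\<in>K. cmod (h x - f x) < e\<close> that by (auto simp: dist_norm norm_minus_commute)
    then show ?thesis
      using e(2) that(1) unfolding s(1) by blast
  qed
  then show ?case
    using s(2) e(1) by blast
qed auto

lemma in_compact_open_closureI:
  assumes f: "f \<in> Cfuns" and S: "S \<subseteq> Cfuns"
    and approx: "\<And>K e. compact K \<Longrightarrow> 0 < e \<Longrightarrow> \<exists>g\<in>S. \<forall>x\<in>K. cmod (g x - f x) \<le> e"
  shows "f \<in> compact_open closure_of S"
  unfolding in_closure_of topspace_compact_open
proof (intro conjI allI impI f)
  fix U assume "f \<in> U \<and> openin compact_open U"
  then obtain K e where K: "compact K" "0 < e"
      "\<And>h. h \<in> Cfuns \<Longrightarrow> (\<And>x. x \<in> K \<Longrightarrow> cmod (h x - f x) < e) \<Longrightarrow> h \<in> U"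
    using compact_open_nhd[of U f] by metis
  obtain g where g: "g \<in> S" "\<forall>x\<in>K. cmod (g x - f x) \<le> e / 2"
    using approx[OF K(1), of "e / 2"] K(2) by auto
  have "g \<in> U"
  proof (rule K(3))
    show "cmod (g x - f x) < e" if "x \<in> K" for x
      using g(2) that K(2) by fastforce
  qed (use g S in blast)
  then show "\<exists>g. g \<in> S \<and> g \<in> U"
    using g(1) by blast
qed

lemma continuous_map_eval_compact_open: "continuous_map compact_open euclidean (\<lambda>f. f x)"
  unfolding continuous_map_def
proof (intro conjI allI impI)
  fix U :: "complex set" assume "openin euclidean U"
  then have U: "open U"
    unfolding open_openin[symmetric] .
  then have "openin compact_open {f \<in> Cfuns. f ` {x} \<subseteq> U}"
    unfolding compact_open_def
    by (intro topology_generated_by_Basis CollectI exI[of _ "{x}"] exI[of _ U] conjI refl)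
      (simp_all add: U)
  then show "openin compact_open {f \<in> topspace compact_open. f x \<in> U}"
    by simp
qed simp

lemma eval_in_Cfuns_dual: "(\<lambda>f. f x) \<in> Cfuns_dual"
  unfolding Cfuns_dual_def linear_map_on_def
  using continuous_map_eval_compact_open by (auto simp: cscale_def)

lemma continuous_map_weak_functional:
  assumes "\<phi> \<in> Cfuns_dual"
  shows "continuous_map weak_Cfuns euclidean \<phi>"
  unfolding continuous_map_def
proof (intro conjI allI impI)
  fix U :: "complex set" assume "openin euclidean U"
  then have U: "open U"
    unfolding open_openin[symmetric] .
  show "openin weak_Cfuns {f \<in> topspace weak_Cfuns. \<phi> f \<in> U}"
    unfolding topspace_weak_Cfuns unfolding weak_Cfuns_def
    using assms U
    by (intro topology_generated_by_Basis CollectI exI[of _ \<phi>] exI[of _ U] conjI refl)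
qed simp

lemma continuous_map_coordinatewise_euclidean:
  fixes f :: "'x \<Rightarrow> 'a \<Rightarrow> complex"
  assumes "\<And>x. continuous_map X euclidean (\<lambda>u. f u x)"
  shows "continuous_map X euclidean f"
  using assms continuous_map_componentwise_UNIV[of X "\<lambda>_. euclidean" f]
  unfolding euclidean_product_topology by simp

lemma continuous_map_compact_open_euclidean: "continuous_map compact_open euclidean (\<lambda>f. f)"
  by (rule continuous_map_coordinatewise_euclidean, rule continuous_map_eval_compact_open)

lemma continuous_map_weak_euclidean: "continuous_map weak_Cfuns euclidean (\<lambda>f. f)"
  by (rule continuous_map_coordinatewise_euclidean,
      rule continuous_map_weak_functional, rule eval_in_Cfuns_dual)

lemma compact_open_closure_subset_pointwise: "compact_open closure_of S \<subseteq> closure S"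
  using continuous_map_image_closure_subset[OF continuous_map_compact_open_euclidean, where S=S]
  by simp

lemma weak_closure_subset_pointwise: "weak_Cfuns closure_of S \<subseteq> closure S"
  using continuous_map_image_closure_subset[OF continuous_map_weak_euclidean, where S=S]
  by simp

lemma compactin_weak_imp_compact:
  assumes "compactin weak_Cfuns A"
  shows "compact A"
  using image_compactin[OF assms continuous_map_weak_euclidean] by simp

lemma compact_open_closure_subset_weak:
  fixes S :: "('a::topological_space \<Rightarrow> complex) set"
  shows "compact_open closure_of S \<subseteq> weak_Cfuns closure_of S"
proof -
  have "continuous_map compact_open weak_Cfuns (\<lambda>f :: 'a \<Rightarrow> complex. f)"
    unfolding weak_Cfuns_def continuous_on_generated_topo_iff
  proof (intro conjI allI impI)
    fix V :: "('a \<Rightarrow> complex) set"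
    assume "V \<in> {{f \<in> Cfuns. \<phi> f \<in> U} |\<phi> U. \<phi> \<in> Cfuns_dual \<and> open U}"
    then obtain \<phi> and U :: "complex set" where V: "V = {f \<in> Cfuns. \<phi> f \<in> U}" "\<phi> \<in> Cfuns_dual" "open U"
      by blast
    have "openin compact_open {f \<in> topspace compact_open. \<phi> f \<in> U}"
      using V(2,3) unfolding Cfuns_dual_def by (intro openin_continuous_map_preimage) auto
    then show "openin compact_open ((\<lambda>f. f) -` V \<inter> topspace compact_open)"
      unfolding V(1) by (simp add: Int_def conj_commute)
  next
    show "(\<lambda>f :: 'a \<Rightarrow> complex. f) ` topspace compact_open \<subseteq>
        \<Union> {{f \<in> Cfuns. \<phi> f \<in> U} |\<phi> U. \<phi> \<in> Cfuns_dual \<and> open U}"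
      using equalityD2[OF topspace_weak_Cfuns[where 'a='a]]
      unfolding weak_Cfuns_def topology_generated_by_topspace image_ident topspace_compact_open .
  qed
  from continuous_map_image_closure_subset[OF this, where S=S] show ?thesis
    by simp
qed

lemma continuous_map_cscale_compact_open:
  "continuous_map compact_open compact_open (cscale c :: ('a::topological_space \<Rightarrow> complex) \<Rightarrow> _)"
proof -
  have "continuous_map compact_open (topology_generated_by
      {{f :: 'a \<Rightarrow> complex \<in> Cfuns. f ` K \<subseteq> U} | K U. compact K \<and> open U}) (cscale c)"
    unfolding continuous_on_generated_topo_iff
  proof (intro conjI allI impI)
    fix V :: "('a \<Rightarrow> complex) set"
    assume "V \<in> {{f \<in> Cfuns. f ` K \<subseteq> U} |K U. compact K \<and> open U}"
    then obtain K and U where V: "V = {f \<in> Cfuns. f ` K \<subseteq> U}" "compact K" "open U"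
      by blast
    have "cscale c -` V \<inter> topspace compact_open = {f \<in> Cfuns. f ` K \<subseteq> (\<lambda>z. c * z) -` U}"
      unfolding V(1) by (auto simp: Cfuns_def cscale_def intro!: continuous_intros)
    moreover have "open ((\<lambda>z. c * z) -` U)"
      using V(3) by (intro open_vimage continuous_intros)
    ultimately show "openin compact_open (cscale c -` V \<inter> topspace compact_open)"
      unfolding compact_open_def using V(2)
      by (auto intro!: topology_generated_by_Basis exI[of _ K] exI[of _ "(\<lambda>z. c * z) -` U"])
  next
    have "cscale c ` Cfuns \<subseteq> topspace (compact_open :: ('a \<Rightarrow> complex) topology)"
      by (auto simp: Cfuns_def cscale_def intro!: continuous_intros)
    then show "cscale c ` topspace compact_open \<subseteq>
        \<Union> {{f :: 'a \<Rightarrow> complex \<in> Cfuns. f ` K \<subseteq> U} |K U. compact K \<and> open U}"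
      unfolding compact_open_def topology_generated_by_topspace topspace_compact_open[unfolded compact_open_def topology_generated_by_topspace] .
  qed
  then show ?thesis
    unfolding compact_open_def[symmetric] .
qed

section \<open>Finite-dimensional separation\<close>

lemma cmod_diff_scaled_square:
  "(cmod (z - complex_of_real t * w))\<^sup>2 = (cmod z)\<^sup>2 - 2 * t * Re (cnj z * w) + t\<^sup>2 * (cmod w)\<^sup>2"
  unfolding cmod_power2 by (simp add: power2_eq_square algebra_simps)

text \<open>Only the values on a finite set \<open>D\<close> matter, so this is the separation of a point from a balanced convex
set in a finite-dimensional space. It is done by hand: if \<open>b \<in> B\<close> almost minimizes the Euclidean
distance \<open>Q\<close> to \<open>g\<close> on \<open>D\<close>, moving from \<open>b\<close> towards any other member of \<open>B\<close> cannot decrease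
\<open>Q\<close> by much, so the functional with coefficients \<open>cnj (g x - b x)\<close> separates \<open>g\<close> from \<open>B\<close>.\<close>
lemma bipolar_pointwise_closure:
  fixes B :: "('a \<Rightarrow> complex) set"
  assumes conv: "convex_funs B" and nonempty: "B \<noteq> {}"
    and balanced: "\<And>f u. f \<in> B \<Longrightarrow> cmod u = 1 \<Longrightarrow> cscale u f \<in> B"
    and bounded: "\<And>f x. f \<in> B \<Longrightarrow> cmod (f x) \<le> M x"
    and polar: "\<And>S c r. finite S \<Longrightarrow> (\<And>f. f \<in> B \<Longrightarrow> cmod (\<Sum>x\<in>S. c x * f x) \<le> r) \<Longrightarrow>
      cmod (\<Sum>x\<in>S. c x * g x) \<le> r"
  shows "g \<in> closure B"
proof (rule ccontr)
  assume "g \<notin> closure B"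
  then obtain D e where D: "finite D" "0 < e" "\<And>f. f \<in> B \<Longrightarrow> \<exists>x\<in>D. e \<le> cmod (f x - g x)"
    unfolding closure_funs_iff by (metis not_le)
  define Q where "Q f = (\<Sum>x\<in>D. (cmod (g x - f x))\<^sup>2)" for f
  have Q_ge: "e\<^sup>2 \<le> Q f" if "f \<in> B" for f
  proof -
    obtain x where x: "x \<in> D" "e \<le> cmod (f x - g x)"
      using D(3) \<open>f \<in> B\<close> by blast
    have "e\<^sup>2 \<le> (cmod (g x - f x))\<^sup>2"
      using x(2) D(2) by (simp add: norm_minus_commute power_mono)
    also have "\<dots> \<le> Q f"
      unfolding Q_def using D(1) x(1) by (intro member_le_sum) auto
    finally show ?thesis .
  qed
  define \<delta> where "\<delta> = (INF f\<in>B. Q f)"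
  have \<delta>: "0 < \<delta>"
  proof -
    have "e\<^sup>2 \<le> \<delta>"
      unfolding \<delta>_def using nonempty Q_ge by (intro cINF_greatest)
    then show ?thesis
      using D(2) by (meson less_le_trans zero_less_power)
  qed
  have bdd: "bdd_below (Q ` B)"
    using Q_ge by (intro bdd_belowI2)
  have \<delta>_le: "\<delta> \<le> Q f" if "f \<in> B" for f
    unfolding \<delta>_def using bdd that by (intro cINF_lower)
  define P where "P = (\<Sum>x\<in>D. (2 * M x)\<^sup>2)"
  have P: "0 \<le> P"
    unfolding P_def by (intro sum_nonneg) simp
  \<comment> \<open>The step towards another member of \<open>B\<close>: the quadratic term \<open>t\<^sup>2 * P\<close> has to stay below
    \<open>t * \<delta>\<close>, and \<open>b\<close> is chosen afterwards with defect at most \<open>t * \<delta>\<close>.\<close>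
  define t where "t = min 1 (\<delta> / (P + 1) / 2)"
  have t: "0 < t" "t \<le> 1"
    unfolding t_def using \<delta> P by auto
  have tP: "t * P < \<delta>"
  proof -
    have "t * P \<le> \<delta> / (P + 1) / 2 * P"
      unfolding t_def using P by (intro mult_right_mono) auto
    also have "\<dots> < \<delta>"
    proof -
      have "0 < P * \<delta> + \<delta> * 2"
        using \<delta> P by (intro add_nonneg_pos mult_nonneg_nonneg) auto
      then show ?thesis
        using P by (simp add: field_simps)
    qed
    finally show ?thesis .
  qed
  obtain b where b: "b \<in> B" "Q b < \<delta> + t * \<delta>"
    using cINF_less_iff[OF nonempty bdd, of "\<delta> + t * \<delta>"] \<delta> t unfolding \<delta>_def[symmetric] by auto
  define c where "c x = cnj (g x - b x)" for x
  define s where "s = \<delta> / 2 + t * P / 2"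
  have improve: "Re (\<Sum>x\<in>D. c x * (f x - b x)) \<le> s" if f: "f \<in> B" for f
  proof -
    let ?k = "cscale (complex_of_real (1 - t)) b + cscale (complex_of_real t) f"
    have "?k \<in> B"
      using conv b(1) f t unfolding convex_funs_def by auto
    then have "\<delta> \<le> Q ?k"
      by (rule \<delta>_le)
    also have "Q ?k = (\<Sum>x\<in>D. (cmod (g x - b x))\<^sup>2 - 2 * t * Re (c x * (f x - b x)) + t\<^sup>2 * (cmod (f x - b x))\<^sup>2)"
    proof -
      have "g x - ?k x = (g x - b x) - complex_of_real t * (f x - b x)" for x
        by (simp add: cscale_def algebra_simps)
      then show ?thesis
        unfolding Q_def c_def by (simp only: cmod_diff_scaled_square)
    qed
    also have "\<dots> = Q b - 2 * t * Re (\<Sum>x\<in>D. c x * (f x - b x)) + t\<^sup>2 * (\<Sum>x\<in>D. (cmod (f x - b x))\<^sup>2)"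
      unfolding Q_def by (simp only: sum.distrib sum_subtractf sum_distrib_left Re_sum)
    also have "\<dots> \<le> Q b - 2 * t * Re (\<Sum>x\<in>D. c x * (f x - b x)) + t\<^sup>2 * P"
    proof -
      have "cmod (f x - b x) \<le> 2 * M x" for x
        using norm_triangle_ineq4[of "f x" "b x"] bounded[OF f, of x] bounded[OF b(1), of x] by linarith
      then have "(\<Sum>x\<in>D. (cmod (f x - b x))\<^sup>2) \<le> P"
        unfolding P_def by (intro sum_mono power_mono) auto
      then show ?thesis
        by (simp add: mult_left_mono)
    qed
    finally have "2 * t * Re (\<Sum>x\<in>D. c x * (f x - b x)) \<le> t * \<delta> + t\<^sup>2 * P"
      using b(2) by linarith
    also have "\<dots> = 2 * t * s"
      unfolding s_def by (simp add: power2_eq_square algebra_simps)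
    finally show ?thesis
      using t(1) by simp
  qed
  have "cmod (\<Sum>x\<in>D. c x * f x) \<le> Re (\<Sum>x\<in>D. c x * b x) + s" if f: "f \<in> B" for f
  proof -
    define w where "w = (\<Sum>x\<in>D. c x * f x)"
    define u where "u = (if w = 0 then 1 else cnj w / complex_of_real (cmod w))"
    have u: "cmod u = 1" "u * w = complex_of_real (cmod w)"
      unfolding u_def by (auto simp: norm_divide complex_norm_square[symmetric] power2_eq_square mult.commute)
    have "(\<Sum>x\<in>D. c x * cscale u f x) = u * w"
      unfolding w_def cscale_def by (simp add: sum_distrib_left mult.left_commute)
    then have "(\<Sum>x\<in>D. c x * (cscale u f x - b x)) = complex_of_real (cmod w) - (\<Sum>x\<in>D. c x * b x)"
      unfolding u(2)[symmetric] by (simp only: right_diff_distrib sum_subtractf)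
    then have "cmod w - Re (\<Sum>x\<in>D. c x * b x) \<le> s"
      using improve[OF balanced[OF f u(1)]] by simp
    then show ?thesis
      unfolding w_def by simp
  qed
  from polar[OF D(1) this] have "cmod (\<Sum>x\<in>D. c x * g x) \<le> Re (\<Sum>x\<in>D. c x * b x) + s" .
  moreover have "Re (\<Sum>x\<in>D. c x * g x) \<le> cmod (\<Sum>x\<in>D. c x * g x)"
    by (rule complex_Re_le_cmod)
  moreover have "Re (\<Sum>x\<in>D. c x * g x) - Re (\<Sum>x\<in>D. c x * b x) = Q b"
  proof -
    have "c x * g x - c x * b x = complex_of_real ((cmod (g x - b x))\<^sup>2)" for x
      unfolding c_def complex_norm_square by (simp add: algebra_simps)
    then have "(\<Sum>x\<in>D. c x * g x) - (\<Sum>x\<in>D. c x * b x) = complex_of_real (Q b)"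
      unfolding Q_def by (simp only: sum_subtractf[symmetric] of_real_sum)
    then show ?thesis
      by (metis Re_complex_of_real minus_complex.sel(1))
  qed
  ultimately have "Q b \<le> s"
    by linarith
  then show False
    using \<delta>_le[OF b(1)] tP unfolding s_def by linarith
qed

section \<open>Functionals on the span of the evaluations\<close>

definition eval_comb :: "('a \<Rightarrow> complex) set \<Rightarrow> 'a set \<Rightarrow> ('a \<Rightarrow> complex) \<Rightarrow> ('a \<Rightarrow> complex) \<Rightarrow> complex"
  where "eval_comb F S c = (\<Sum>x\<in>S. cscale (c x) (point_eval F x))"

lemma sum_funs_apply: "(\<Sum>i\<in>S. f i) x = (\<Sum>i\<in>S. f i x)"
  for f :: "'i \<Rightarrow> 'b \<Rightarrow> 'c::comm_monoid_add"
  by (induction S rule: infinite_finite_induct) simp_all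

lemma eval_comb_apply: "f \<in> F \<Longrightarrow> eval_comb F S c f = (\<Sum>x\<in>S. c x * f x)"
  unfolding eval_comb_def sum_funs_apply by (simp add: cscale_def point_eval_def)

lemma eval_comb_extend:
  assumes "finite T" "S \<subseteq> T"
  shows "eval_comb F S c = eval_comb F T (\<lambda>x. if x \<in> S then c x else 0)"
    and "(\<Sum>x\<in>S. c x * g x) = (\<Sum>x\<in>T. (if x \<in> S then c x else 0) * g x)"
  unfolding eval_comb_def using assms
  by (auto intro!: sum.mono_neutral_cong_left)

lemma eval_comb_add: "eval_comb F S c + eval_comb F S d = eval_comb F S (\<lambda>x. c x + d x)"
  unfolding eval_comb_def by (simp add: cfun.scale_left_distrib sum.distrib)

lemma eval_comb_diff: "eval_comb F S c - eval_comb F S d = eval_comb F S (\<lambda>x. c x - d x)"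
  unfolding eval_comb_def by (simp add: cfun.scale_left_diff_distrib sum_subtractf)

lemma eval_comb_scale: "cscale a (eval_comb F S c) = eval_comb F S (\<lambda>x. a * c x)"
  unfolding eval_comb_def by (simp add: cfun.scale_sum_right)

lemma point_eval_eq_comb: "point_eval F x = eval_comb F {x} (\<lambda>_. 1)"
  unfolding eval_comb_def by simp

lemma eval_comb_in_span: "eval_comb F S c \<in> eval_span F"
  unfolding eval_comb_def eval_span_def
  by (intro cfun.span_sum cfun.span_scale cfun.span_base) simp

lemma eval_comb_common:
  assumes "finite S" "finite T"
  obtains c' d' where "eval_comb F S c = eval_comb F (S \<union> T) c'" "eval_comb F T d = eval_comb F (S \<union> T) d'"
    "\<And>g. (\<Sum>x\<in>S. c x * g x) = (\<Sum>x\<in>S \<union> T. c' x * g x)"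
    "\<And>g. (\<Sum>x\<in>T. d x * g x) = (\<Sum>x\<in>S \<union> T. d' x * g x)"
  by (rule that, rule eval_comb_extend(1), use assms in simp, simp, rule eval_comb_extend(1),
      use assms in simp, simp, rule eval_comb_extend(2), use assms in simp, simp,
      rule eval_comb_extend(2), use assms in simp, simp)

lemma eval_span_cases:
  assumes "e \<in> eval_span F"
  obtains S c where "finite S" "e = eval_comb F S c"
proof -
  have "\<exists>S c. finite S \<and> e = eval_comb F S c"
    using assms unfolding eval_span_def
  proof (induction rule: cfun.span_induct_alt)
    case base
    show ?case
      by (intro exI[of _ "{}"]) (simp add: eval_comb_def)
  next
    case (step a p y)
    then obtain x S c where x: "p = point_eval F x" and S: "finite S" "y = eval_comb F S c"
      by blast
    have px: "cscale a p = eval_comb F {x} (\<lambda>_. a)"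
      unfolding x by (simp add: eval_comb_def)
    obtain c' d' where "cscale a p = eval_comb F ({x} \<union> S) c'" "y = eval_comb F ({x} \<union> S) d'"
      unfolding px S(2) by (rule eval_comb_common[of "{x}" S F "\<lambda>_. a" c]) (use S(1) in auto)
    then have "cscale a p + y = eval_comb F ({x} \<union> S) (\<lambda>z. c' z + d' z)"
      by (simp only: eval_comb_add)
    then show ?case
      using S(1) by (intro exI[of _ "{x} \<union> S"] exI[of _ "\<lambda>z. c' z + d' z"]) simp
  qed
  then show thesis
    using that by blast
qed

text \<open>The point evaluations may be linearly dependent, or coincide, so the coefficients of an element of the span
are a choice.\<close>
definition eval_coeffs :: "('a \<Rightarrow> complex) set \<Rightarrow> (('a \<Rightarrow> complex) \<Rightarrow> complex) \<Rightarrow> 'a set \<times> ('a \<Rightarrow> complex)"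
  where "eval_coeffs F e = (SOME (S, c). finite S \<and> e = eval_comb F S c)"

text \<open>The functional determined by \<open>point_eval F x \<mapsto> g x\<close>. The coefficients depend on \<open>e\<close> alone, which
makes \<open>induced F g\<close> additive in \<open>g\<close> by construction; it is linear in \<open>e\<close> only for those \<open>g\<close>
that respect the linear relations between the evaluations.\<close>
definition induced :: "('a \<Rightarrow> complex) set \<Rightarrow> ('a \<Rightarrow> complex) \<Rightarrow> (('a \<Rightarrow> complex) \<Rightarrow> complex) \<Rightarrow> complex"
  where "induced F g e =
    (if e \<in> eval_span F then \<Sum>x\<in>fst (eval_coeffs F e). snd (eval_coeffs F e) x * g x else 0)"

lemma eval_coeffs:
  assumes "e \<in> eval_span F"
  shows "finite (fst (eval_coeffs F e))" "e = eval_comb F (fst (eval_coeffs F e)) (snd (eval_coeffs F e))"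
proof -
  obtain S c where "finite S" "e = eval_comb F S c"
    using eval_span_cases[OF assms] .
  then have "\<exists>Sc. case Sc of (S, c) \<Rightarrow> finite S \<and> e = eval_comb F S c"
    by auto
  from someI_ex[OF this]
  show "finite (fst (eval_coeffs F e))" "e = eval_comb F (fst (eval_coeffs F e)) (snd (eval_coeffs F e))"
    unfolding eval_coeffs_def by (simp_all add: case_prod_unfold)
qed

lemma linear_map_on_induced: "linear_map_on cscale cscale V (induced F)"
  unfolding linear_map_on_def induced_def
  by (auto simp: fun_eq_iff cscale_def sum.distrib sum_distrib_left algebra_simps)

lemma linear_map_on_eval_comb:
  assumes "linear_map_on cscale (*) (eval_span F) \<phi>" "finite S"
  shows "\<phi> (eval_comb F S c) = (\<Sum>x\<in>S. c x * \<phi> (point_eval F x))"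
  using assms(2)
proof (induction S)
  case empty
  have "\<phi> (cscale 0 (eval_comb F {} c)) = 0 * \<phi> (eval_comb F {} c)"
    using assms(1) eval_comb_in_span unfolding linear_map_on_def by blast
  then show ?case
    by (simp add: eval_comb_def zero_fun_def)
next
  case (insert x S)
  have pe: "point_eval F x \<in> eval_span F"
    unfolding eval_span_def by (intro cfun.span_base) simp
  then have spe: "cscale (c x) (point_eval F x) \<in> eval_span F"
    unfolding eval_span_def by (rule cfun.span_scale)
  have "eval_comb F (insert x S) c = cscale (c x) (point_eval F x) + eval_comb F S c"
    unfolding eval_comb_def using insert by simp
  then have "\<phi> (eval_comb F (insert x S) c) = \<phi> (cscale (c x) (point_eval F x)) + \<phi> (eval_comb F S c)"
    using assms(1) spe eval_comb_in_span unfolding linear_map_on_def by metis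
  also have "\<phi> (cscale (c x) (point_eval F x)) = c x * \<phi> (point_eval F x)"
    using assms(1) pe unfolding linear_map_on_def by blast
  finally show ?case
    using insert by simp
qed

section \<open>The unit ball and its closures\<close>

context
  fixes F :: "('a::topological_space \<Rightarrow> complex) set" and N :: "('a \<Rightarrow> complex) \<Rightarrow> real"
  assumes nscf: "nscf F N"
begin

lemma nscf_normed_space: "normed_space_on F N"
  using nscf unfolding nscf_def by blast

lemma unit_ball_subset_Cfuns: "unit_ball F N \<subseteq> Cfuns"
  using nscf unfolding nscf_def unit_ball_def by blast

lemma zero_in_unit_ball: "0 \<in> unit_ball F N"
  using nscf_normed_space cfun.subspace_0 unfolding normed_space_on_def unit_ball_def by fastforce

lemma cscale_in_unit_ball:
  assumes "f \<in> unit_ball F N" "cmod c \<le> 1"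
  shows "cscale c f \<in> unit_ball F N"
  using assms nscf_normed_space cfun.subspace_scale unfolding normed_space_on_def unit_ball_def
  by (auto intro!: mult_le_one)

lemma convex_funs_unit_ball: "convex_funs (unit_ball F N)"
  unfolding convex_funs_def
proof (intro ballI)
  fix f g and t :: real
  assume fg: "f \<in> unit_ball F N" "g \<in> unit_ball F N" and t: "t \<in> {0..1}"
  let ?f = "cscale (complex_of_real (1 - t)) f" and ?g = "cscale (complex_of_real t) g"
  have sub: "cfun.subspace F"
    using nscf_normed_space unfolding normed_space_on_def by blast
  have fg': "f \<in> F" "g \<in> F" "N f \<le> 1" "N g \<le> 1"
    using fg unfolding unit_ball_def by auto
  have in_F: "?f \<in> F" "?g \<in> F" "?f + ?g \<in> F"
    using cfun.subspace_scale[OF sub] cfun.subspace_add[OF sub] fg' by simp_all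
  have "N (?f + ?g) \<le> N ?f + N ?g"
    using nscf_normed_space in_F unfolding normed_space_on_def by blast
  also have "\<dots> = (1 - t) * N f + t * N g"
    using nscf_normed_space fg' t unfolding normed_space_on_def by (simp del: of_real_diff)
  also have "\<dots> \<le> 1"
    using fg' t by (intro convex_bound_le) auto
  finally show "?f + ?g \<in> unit_ball F N"
    using in_F unfolding unit_ball_def by blast
qed

text \<open>This is where continuity of the inclusion enters: the functions below 1 in modulus on \<open>K\<close> form a
neighbourhood of 0, so they contain a small ball of \<open>F\<close>. The bound survives pointwise limits.\<close>
lemma unit_ball_bounded_on_compact:
  assumes K: "compact K"
  obtains M where "0 < M" "\<And>f x. f \<in> closure (unit_ball F N) \<Longrightarrow> x \<in> K \<Longrightarrow> cmod (f x) \<le> M"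
proof -
  interpret Metric_space F "norm_dist F N"
    using Metric_space_norm_dist[OF nscf_normed_space] .
  have sub: "cfun.subspace F"
    using nscf_normed_space unfolding normed_space_on_def by blast
  have scale: "cscale c f \<in> F" "N (cscale c f) = cmod c * N f" if "f \<in> F" for c f
    using nscf_normed_space cfun.subspace_scale[OF sub that] that unfolding normed_space_on_def by simp_all
  have zero: "0 \<in> F"
    using zero_in_unit_ball unfolding unit_ball_def by blast
  define V where "V = {f \<in> Cfuns. f ` K \<subseteq> ball 0 1}"
  have "openin compact_open V"
    unfolding V_def compact_open_def using K
    by (intro topology_generated_by_Basis CollectI exI[of _ K] exI[of _ "ball 0 1"] conjI refl) auto
  then have "openin mtopology {f \<in> topspace mtopology. f \<in> V}"
    using nscf unfolding nscf_def norm_topology_def by (intro openin_continuous_map_preimage) auto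
  moreover have "0 \<in> V"
    unfolding V_def Cfuns_def by (auto simp: zero_fun_def)
  ultimately have "\<exists>r>0. mball 0 r \<subseteq> {f \<in> topspace mtopology. f \<in> V}"
    unfolding openin_mtopology using zero by auto
  then obtain r where r: "0 < r" "mball 0 r \<subseteq> V"
    by blast
  have bound: "cmod (f x) \<le> 2 / r" if f: "f \<in> unit_ball F N" and x: "x \<in> K" for f x
  proof -
    have f': "f \<in> F" "N f \<le> 1"
      using f unfolding unit_ball_def by auto
    have "0 - cscale (complex_of_real (r / 2)) f = cscale (complex_of_real (- (r / 2))) f"
      by (rule ext) (simp add: cscale_def)
    then have "norm_dist F N 0 (cscale (complex_of_real (r / 2)) f) = r / 2 * N f"
      unfolding norm_dist_def using zero scale[OF f'(1)] r(1) by (simp del: of_real_minus of_real_divide)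
    also have "\<dots> \<le> r / 2 * 1"
      using f'(2) r(1) by (intro mult_left_mono) auto
    also have "\<dots> < r"
      using r(1) by simp
    finally have "cscale (complex_of_real (r / 2)) f \<in> V"
      using r(2) zero scale[OF f'(1)] by auto
    then have "cscale (complex_of_real (r / 2)) f x \<in> ball 0 1"
      unfolding V_def using x by blast
    then show ?thesis
      using r(1) by (simp add: cscale_def norm_mult field_simps)
  qed
  have "closure (unit_ball F N) \<subseteq> {f. cmod (f x) \<le> 2 / r}" if "x \<in> K" for x
    using bound[OF _ that]
    by (intro closure_minimal closed_Collect_le continuous_intros) auto
  then show thesis
    using that[of "2 / r"] r(1) by auto
qed

lemma unit_ball_bounded_at_points:
  "\<exists>M. \<forall>h\<in>closure (unit_ball F N). \<forall>x. cmod (h x) \<le> M x"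
proof -
  have "\<exists>M. \<forall>h\<in>closure (unit_ball F N). cmod (h x) \<le> M" for x
    using unit_ball_bounded_on_compact[of "{x}"] by (metis compact_sing insertI1)
  then show ?thesis
    by metis
qed

lemma unit_ball_subset_ball_closure: "unit_ball F N \<subseteq> ball_closure F N"
  unfolding ball_closure_def using unit_ball_subset_Cfuns by (intro closure_of_subset) simp

lemma ball_closure_subset_Cfuns: "ball_closure F N \<subseteq> Cfuns"
  unfolding ball_closure_def using closure_of_subset_topspace[of compact_open] by simp

lemma ball_closure_subset_closure: "ball_closure F N \<subseteq> closure (unit_ball F N)"
  unfolding ball_closure_def by (rule compact_open_closure_subset_pointwise)

lemma ball_closure_eq_closure:
  assumes "compact (ball_closure F N)"
  shows "ball_closure F N = closure (unit_ball F N)"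
  using ball_closure_subset_closure unit_ball_subset_ball_closure
    closure_minimal compact_funs_imp_closed[OF assms] by blast

section \<open>Weak compactness and pointwise compactness\<close>

text \<open>A pointwise compact set of continuous functions between the unit ball and its pointwise closure adds nothing to
the compact-open closure.\<close>
lemma pointwise_compact_subset_ball_closure:
  assumes A: "compact A" "unit_ball F N \<subseteq> A" "A \<subseteq> Cfuns" "A \<subseteq> closure (unit_ball F N)"
  shows "A \<subseteq> ball_closure F N"
proof
  fix f assume f: "f \<in> A"
  show "f \<in> ball_closure F N"
    unfolding ball_closure_def
  proof (rule in_compact_open_closureI[OF _ unit_ball_subset_Cfuns])
    show "f \<in> Cfuns"
      using f A(3) by blast
    fix K :: "'a set" and e :: real assume K: "compact K" "0 < e"
    obtain M where "\<And>f x. f \<in> closure (unit_ball F N) \<Longrightarrow> x \<in> K \<Longrightarrow> cmod (f x) \<le> M"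
      using unit_ball_bounded_on_compact[OF K(1)] by blast
    then show "\<exists>g\<in>unit_ball F N. \<forall>x\<in>K. cmod (g x - f x) \<le> e"
      using f A K(2)
      by (intro convex_pointwise_closure_uniform[OF K(1) A(1,3) _ A(2) convex_funs_unit_ball]) blast+
  qed
qed

text \<open>Superlevel sets of \<open>Re (c * \<phi> f)\<close> in \<open>A\<close> are convex, so a member of \<open>A\<close> in the pointwise closure of
such a set is approximated by it uniformly on any compact set, and \<open>\<phi>\<close> is continuous for uniform
approximation on a suitable compact set. Taking \<open>c = 1, -1\<close> and \<open>c = -\<i>, \<i>\<close> controls the real and
imaginary parts of \<open>\<phi>\<close> from both sides.\<close>
lemma functional_continuous_on_pointwise_compact:
  assumes A: "compact A" "A \<subseteq> Cfuns" "A \<subseteq> closure (unit_ball F N)" "convex_funs A"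
    and \<phi>: "\<phi> \<in> Cfuns_dual"
  shows "continuous_on A \<phi>"
proof -
  have superlevel: "t \<le> Re (c * \<phi> f0)"
    if f0: "f0 \<in> A" "f0 \<in> closure {f \<in> A. t \<le> Re (c * \<phi> f)}" for t c f0
  proof (rule ccontr)
    assume "\<not> t \<le> Re (c * \<phi> f0)"
    have add: "\<phi> (f + g) = \<phi> f + \<phi> g" if "f \<in> Cfuns" "g \<in> Cfuns" for f g
      using \<phi> that unfolding Cfuns_dual_def linear_map_on_def by blast
    have scale: "\<phi> (cscale a f) = a * \<phi> f" "cscale a f \<in> Cfuns" if "f \<in> Cfuns" for f a
      using \<phi> that unfolding Cfuns_dual_def linear_map_on_def
      by (auto simp: Cfuns_def cscale_def intro!: continuous_intros)
    have Re_comb: "Re (complex_of_real a * z + complex_of_real b * w) = a * Re z + b * Re w" for a b z w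
      by simp
    let ?S = "{f \<in> A. t \<le> Re (c * \<phi> f)}"
    have "convex_funs ?S"
      unfolding convex_funs_def
    proof (intro ballI)
      fix f g and s :: real assume fg: "f \<in> ?S" "g \<in> ?S" and s: "s \<in> {0..1}"
      let ?k = "cscale (complex_of_real (1 - s)) f + cscale (complex_of_real s) g"
      have fg_Cfuns: "f \<in> Cfuns" "g \<in> Cfuns"
        using fg A(2) by auto
      have "c * \<phi> ?k = complex_of_real (1 - s) * (c * \<phi> f) + complex_of_real s * (c * \<phi> g)"
        unfolding add[OF scale(2)[OF fg_Cfuns(1)] scale(2)[OF fg_Cfuns(2)]] scale(1)[OF fg_Cfuns(1)]
          scale(1)[OF fg_Cfuns(2)]
        by (simp only: distrib_left mult.left_commute)
      then have "- Re (c * \<phi> ?k) = (1 - s) * - Re (c * \<phi> f) + s * - Re (c * \<phi> g)"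
        by (simp only: Re_comb mult_minus_right minus_add_distrib)
      also have "\<dots> \<le> - t"
        using fg s by (intro convex_bound_le) auto
      finally show "?k \<in> ?S"
        using fg s A(4) unfolding convex_funs_def by auto
    qed
    note S = this
    have U: "openin compact_open {f \<in> topspace compact_open. \<phi> f \<in> {z. Re (c * z) < t}}"
      using \<phi> unfolding Cfuns_dual_def
      by (intro openin_continuous_map_preimage[where Y=euclidean])
        (auto intro!: open_Collect_less continuous_intros)
    have "f0 \<in> {f \<in> topspace compact_open. \<phi> f \<in> {z. Re (c * z) < t}}"
      using \<open>\<not> t \<le> Re (c * \<phi> f0)\<close> f0(1) A(2) by auto
    from compact_open_nhd[OF U this] obtain K e where K: "compact K" "0 < e"
      and near: "\<forall>h\<in>Cfuns. (\<forall>x\<in>K. cmod (h x - f0 x) < e) \<longrightarrow>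
        h \<in> {f \<in> topspace compact_open. \<phi> f \<in> {z. Re (c * z) < t}}"
      by (elim exE conjE)
    obtain M where M: "\<And>f x. f \<in> closure (unit_ball F N) \<Longrightarrow> x \<in> K \<Longrightarrow> cmod (f x) \<le> M"
      using unit_ball_bounded_on_compact[OF K(1)] by blast
    have "\<exists>g\<in>?S. \<forall>x\<in>K. cmod (g x - f0 x) \<le> e / 2"
      using M A(3) K(2)
      by (intro convex_pointwise_closure_uniform[OF K(1) A(1,2) _ _ S f0]) auto
    then obtain g where g: "g \<in> ?S" "\<forall>x\<in>K. cmod (g x - f0 x) \<le> e / 2"
      by blast
    have "\<forall>x\<in>K. cmod (g x - f0 x) < e"
      using g(2) K(2) by fastforce
    moreover have "g \<in> Cfuns"
      using g(1) A(2) by blast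
    ultimately have "Re (c * \<phi> g) < t"
      using near by blast
    then show False
      using g(1) by simp
  qed
  have lower: "\<forall>\<^sub>F f in at f0 within A. Re (c * \<phi> f) < t"
    if f0: "f0 \<in> A" and less: "Re (c * \<phi> f0) < t" for f0 t c
  proof -
    let ?S = "{f \<in> A. t \<le> Re (c * \<phi> f)}"
    have "f0 \<in> - closure ?S"
      using superlevel[OF f0] less by fastforce
    moreover have "\<forall>f\<in>A. f \<in> - closure ?S \<longrightarrow> Re (c * \<phi> f) < t"
      using closure_subset[of ?S] by fastforce
    ultimately show ?thesis
      unfolding eventually_at_topological by (intro exI[of _ "- closure ?S"]) auto
  qed
  have "((\<lambda>f. Re (c * \<phi> f)) \<longlongrightarrow> Re (c * \<phi> f0)) (at f0 within A)" if "f0 \<in> A" for c f0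
  proof (rule order_tendstoI)
    have neg: "Re (- c * z) < - a \<longleftrightarrow> a < Re (c * z)" for a z
      by auto
    show "\<forall>\<^sub>F f in at f0 within A. a < Re (c * \<phi> f)" if "a < Re (c * \<phi> f0)" for a
      using lower[OF \<open>f0 \<in> A\<close>, of "- c" "- a"] that unfolding neg by blast
  qed (rule lower[OF that])
  from this[of _ 1] this[of _ "- \<i>"]
  have "((\<lambda>f. Complex (Re (\<phi> f)) (Im (\<phi> f))) \<longlongrightarrow> Complex (Re (\<phi> f0)) (Im (\<phi> f0))) (at f0 within A)"
    if "f0 \<in> A" for f0
    using that by (intro tendsto_Complex) auto
  then show ?thesis
    unfolding continuous_on_def by simp
qed

lemma weakly_compactly_embedded_iff:
  "weakly_compactly_embedded F N \<longleftrightarrow> compactin pointwise (ball_closure F N)"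
proof
  assume "weakly_compactly_embedded F N"
  then have W: "compactin weak_Cfuns (weak_Cfuns closure_of unit_ball F N)"
    unfolding weakly_compactly_embedded_def .
  have "weak_Cfuns closure_of unit_ball F N \<subseteq> ball_closure F N"
  proof (rule pointwise_compact_subset_ball_closure)
    show "compact (weak_Cfuns closure_of unit_ball F N)"
      using compactin_weak_imp_compact[OF W] .
    show "unit_ball F N \<subseteq> weak_Cfuns closure_of unit_ball F N"
      using unit_ball_subset_Cfuns by (intro closure_of_subset) simp
    show "weak_Cfuns closure_of unit_ball F N \<subseteq> Cfuns"
      using closure_of_subset_topspace[of weak_Cfuns] by simp
    show "weak_Cfuns closure_of unit_ball F N \<subseteq> closure (unit_ball F N)"
      by (rule weak_closure_subset_pointwise)
  qed
  then have "weak_Cfuns closure_of unit_ball F N = ball_closure F N"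
    using compact_open_closure_subset_weak unfolding ball_closure_def by blast
  then show "compactin pointwise (ball_closure F N)"
    unfolding compactin_pointwise_iff
    using compactin_weak_imp_compact[OF W] ball_closure_subset_Cfuns by simp
next
  assume "compactin pointwise (ball_closure F N)"
  then have A: "compact (ball_closure F N)" "ball_closure F N \<subseteq> Cfuns"
    unfolding compactin_pointwise_iff by auto
  note A_eq = ball_closure_eq_closure[OF A(1)]
  have cont: "continuous_on (ball_closure F N) \<phi>" if "\<phi> \<in> Cfuns_dual" for \<phi>
    using functional_continuous_on_pointwise_compact[OF A _ _ that]
      convex_funs_closure[OF convex_funs_unit_ball] unfolding A_eq by blast
  have "continuous_map (top_of_set (ball_closure F N)) weak_Cfuns (\<lambda>f. f)"
    unfolding weak_Cfuns_def continuous_on_generated_topo_iff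
  proof (intro conjI allI impI)
    fix V :: "('a \<Rightarrow> complex) set"
    assume "V \<in> {{f \<in> Cfuns. \<phi> f \<in> U} |\<phi> U. \<phi> \<in> Cfuns_dual \<and> open U}"
    then obtain \<phi> and U :: "complex set" where V: "V = {f \<in> Cfuns. \<phi> f \<in> U}" "\<phi> \<in> Cfuns_dual" "open U"
      by blast
    have "(\<lambda>f. f) -` V \<inter> topspace (top_of_set (ball_closure F N)) = ball_closure F N \<inter> \<phi> -` U"
      using A(2) unfolding V(1) by auto
    then show "openin (top_of_set (ball_closure F N)) ((\<lambda>f. f) -` V \<inter> topspace (top_of_set (ball_closure F N)))"
      using continuous_openin_preimage_gen[OF cont[OF V(2)] V(3)] by simp
  next
    show "(\<lambda>f. f) ` topspace (top_of_set (ball_closure F N)) \<subseteq>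
        \<Union> {{f \<in> Cfuns. \<phi> f \<in> U} |\<phi> U. \<phi> \<in> Cfuns_dual \<and> open U}"
      using order_trans[OF A(2) equalityD2[OF topspace_weak_Cfuns[where 'a='a]]]
      unfolding weak_Cfuns_def topology_generated_by_topspace image_ident topspace_euclidean_subtopology .
  qed
  from image_compactin[OF _ this, of "ball_closure F N"]
  have "compactin weak_Cfuns (ball_closure F N)"
    using A(1) by (simp add: compactin_subtopology)
  moreover have "weak_Cfuns closure_of unit_ball F N \<subseteq> ball_closure F N"
    using weak_closure_subset_pointwise unfolding A_eq .
  ultimately show "weakly_compactly_embedded F N"
    unfolding weakly_compactly_embedded_def using closed_compactin closedin_closure_of by metis
qed

section \<open>Duality with the span of the evaluations\<close>

lemma dual_norm_zero: "dual_norm F N 0 = 0"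
proof -
  have "unit_ball F N \<noteq> {}"
    using zero_in_unit_ball by blast
  then show ?thesis
    unfolding dual_norm_def by simp
qed

lemma functional_le_dual_norm:
  assumes e: "e \<in> eval_span F" and f: "f \<in> unit_ball F N"
  shows "cmod (e f) \<le> dual_norm F N e"
proof -
  obtain S c where S: "finite S" "e = eval_comb F S c"
    using eval_span_cases[OF e] .
  obtain M where M: "\<And>h x. h \<in> closure (unit_ball F N) \<Longrightarrow> cmod (h x) \<le> M x"
    using unit_ball_bounded_at_points by blast
  have "cmod (e h) \<le> (\<Sum>x\<in>S. cmod (c x) * M x)" if h: "h \<in> unit_ball F N" for h
  proof -
    have "h \<in> F"
      using h unfolding unit_ball_def by blast
    then have "e h = (\<Sum>x\<in>S. c x * h x)"
      unfolding S(2) by (rule eval_comb_apply)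
    also have "cmod \<dots> \<le> (\<Sum>x\<in>S. cmod (c x) * M x)"
      using M[OF subsetD[OF closure_subset h]] by (intro sum_norm_le) (simp add: norm_mult mult_left_mono)
    finally show ?thesis .
  qed
  then have "bdd_above ((\<lambda>h. cmod (e h)) ` unit_ball F N)"
    by (intro bdd_aboveI2)
  then show ?thesis
    unfolding dual_norm_def using f by (intro cSUP_upper)
qed

lemma dual_norm_le:
  assumes "\<And>f. f \<in> unit_ball F N \<Longrightarrow> cmod (e f) \<le> r"
  shows "dual_norm F N e \<le> r"
proof -
  have "unit_ball F N \<noteq> {}"
    using zero_in_unit_ball by blast
  then show ?thesis
    unfolding dual_norm_def using assms by (intro cSUP_least)
qed

lemma dual_norm_nonneg: "e \<in> eval_span F \<Longrightarrow> 0 \<le> dual_norm F N e"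
  using functional_le_dual_norm[OF _ zero_in_unit_ball] norm_ge_zero order_trans by blast

lemma dual_norm_cscale_le:
  assumes "e \<in> eval_span F"
  shows "dual_norm F N (cscale a e) \<le> cmod a * dual_norm F N e"
  using functional_le_dual_norm[OF assms]
  by (intro dual_norm_le) (simp add: cscale_def norm_mult mult_left_mono)

text \<open>The estimate holds on the unit ball by definition of the norm, and it is a closed condition on finitely many
point values.\<close>
lemma sum_le_dual_norm:
  assumes S: "finite S" and p: "p \<in> closure (unit_ball F N)"
  shows "cmod (\<Sum>x\<in>S. c x * p x) \<le> dual_norm F N (eval_comb F S c)"
proof -
  let ?r = "dual_norm F N (eval_comb F S c)"
  have "closed {p. cmod (\<Sum>x\<in>S. c x * p x) \<le> ?r}"
    by (intro closed_Collect_le continuous_intros continuous_on_product_coordinates)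
  moreover have "unit_ball F N \<subseteq> {p. cmod (\<Sum>x\<in>S. c x * p x) \<le> ?r}"
  proof
    fix f assume f: "f \<in> unit_ball F N"
    then have "f \<in> F"
      unfolding unit_ball_def by blast
    from eval_comb_apply[OF this, of S c] functional_le_dual_norm[OF eval_comb_in_span f, of S c]
    show "f \<in> {p. cmod (\<Sum>x\<in>S. c x * p x) \<le> ?r}"
      by simp
  qed
  ultimately have "closure (unit_ball F N) \<subseteq> {p. cmod (\<Sum>x\<in>S. c x * p x) \<le> ?r}"
    by (intro closure_minimal)
  then show ?thesis
    using p by blast
qed

text \<open>Independence of the chosen coefficients: the difference of two representations is the zero functional, so by
the norm estimate it also annihilates \<open>p\<close>.\<close>
lemma induced_eval_comb:
  assumes p: "p \<in> closure (unit_ball F N)" and S: "finite S"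
  shows "induced F (cscale \<alpha> p) (eval_comb F S c) = (\<Sum>x\<in>S. c x * cscale \<alpha> p x)"
proof -
  let ?e = "eval_comb F S c"
  define T d where "T = fst (eval_coeffs F ?e)" and "d = snd (eval_coeffs F ?e)"
  have T: "finite T" "?e = eval_comb F T d"
    unfolding T_def d_def using eval_coeffs[OF eval_comb_in_span[of F S c]] by auto
  obtain c' d' where c': "?e = eval_comb F (S \<union> T) c'" "eval_comb F T d = eval_comb F (S \<union> T) d'"
    and sums: "\<And>g. (\<Sum>x\<in>S. c x * g x) = (\<Sum>x\<in>S \<union> T. c' x * g x)"
      "\<And>g. (\<Sum>x\<in>T. d x * g x) = (\<Sum>x\<in>S \<union> T. d' x * g x)"
    by (rule eval_comb_common[OF S T(1), of F c d]) (rule that; assumption)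
  have "eval_comb F (S \<union> T) (\<lambda>x. d' x - c' x) = 0"
    using c' T(2) by (simp flip: eval_comb_diff)
  then have "cmod (\<Sum>x\<in>S \<union> T. (d' x - c' x) * p x) \<le> 0"
    using sum_le_dual_norm[OF finite_UnI[OF S T(1)] p, of "\<lambda>x. d' x - c' x"] dual_norm_zero by simp
  then have eq: "(\<Sum>x\<in>T. d x * p x) = (\<Sum>x\<in>S. c x * p x)"
    unfolding sums by (simp add: left_diff_distrib sum_subtractf)
  have "(\<Sum>x\<in>U. q x * cscale \<alpha> p x) = \<alpha> * (\<Sum>x\<in>U. q x * p x)" for U q
    unfolding cscale_def by (simp add: sum_distrib_left mult.left_commute)
  then have "(\<Sum>x\<in>T. d x * cscale \<alpha> p x) = (\<Sum>x\<in>S. c x * cscale \<alpha> p x)"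
    using eq by simp
  then show ?thesis
    unfolding induced_def T_def d_def using eval_comb_in_span[of F S c] by simp
qed

lemma induced_point_eval:
  assumes "p \<in> closure (unit_ball F N)"
  shows "induced F (cscale \<alpha> p) (point_eval F x) = cscale \<alpha> p x"
  unfolding point_eval_eq_comb using induced_eval_comb[OF assms, of "{x}"] by simp

lemma induced_in_dual_space:
  assumes p: "p \<in> closure (unit_ball F N)" and \<alpha>: "0 \<le> \<alpha>"
  defines "\<phi> \<equiv> induced F (cscale (complex_of_real \<alpha>) p)"
  shows "\<phi> \<in> dual_space (eval_span F) (dual_norm F N)"
    and "dual_norm (eval_span F) (dual_norm F N) \<phi> \<le> \<alpha>"
proof -
  have sub: "cfun.subspace (eval_span F)"
    unfolding eval_span_def by (rule cfun.subspace_span)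
  have bound: "cmod (\<phi> e) \<le> \<alpha> * dual_norm F N e" if e: "e \<in> eval_span F" for e
  proof -
    obtain S c where S: "finite S" "e = eval_comb F S c"
      using eval_span_cases[OF e] .
    have "\<phi> e = complex_of_real \<alpha> * (\<Sum>x\<in>S. c x * p x)"
      unfolding \<phi>_def S(2) induced_eval_comb[OF p S(1)]
      by (simp add: cscale_def sum_distrib_left mult.left_commute)
    then show ?thesis
      using sum_le_dual_norm[OF S(1) p, of c] \<alpha> S(2) by (simp add: norm_mult mult_left_mono)
  qed
  have "linear_map_on cscale (*) (eval_span F) \<phi>"
    unfolding linear_map_on_def
  proof (intro conjI ballI allI)
    fix u v assume u: "u \<in> eval_span F" and v: "v \<in> eval_span F"
    obtain S c where S: "finite S" "u = eval_comb F S c"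
      using eval_span_cases[OF u] .
    obtain T d where T: "finite T" "v = eval_comb F T d"
      using eval_span_cases[OF v] .
    obtain c' d' where "u = eval_comb F (S \<union> T) c'" "v = eval_comb F (S \<union> T) d'"
      unfolding S(2) T(2) by (rule eval_comb_common[OF S(1) T(1), of F c d])
    then show "\<phi> (u + v) = \<phi> u + \<phi> v"
      unfolding \<phi>_def using S(1) T(1)
      by (simp add: eval_comb_add induced_eval_comb[OF p] distrib_right sum.distrib)
  next
    fix a v assume v: "v \<in> eval_span F"
    obtain S c where S: "finite S" "v = eval_comb F S c"
      using eval_span_cases[OF v] .
    then show "\<phi> (cscale a v) = a * \<phi> v"
      unfolding \<phi>_def
      by (simp add: eval_comb_scale induced_eval_comb[OF p] sum_distrib_left mult.assoc)
  qed
  moreover have "\<phi> e = 0" if "e \<notin> eval_span F" for e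
    using that unfolding \<phi>_def induced_def by simp
  ultimately show "\<phi> \<in> dual_space (eval_span F) (dual_norm F N)"
    unfolding dual_space_def using bound by blast
  have "0 \<in> unit_ball (eval_span F) (dual_norm F N)"
    unfolding unit_ball_def using cfun.subspace_0[OF sub] dual_norm_zero by simp
  moreover have "cmod (\<phi> e) \<le> \<alpha>" if "e \<in> unit_ball (eval_span F) (dual_norm F N)" for e
  proof -
    have e: "e \<in> eval_span F" "dual_norm F N e \<le> 1"
      using that unfolding unit_ball_def by auto
    have "\<alpha> * dual_norm F N e \<le> \<alpha> * 1"
      using e(2) \<alpha> by (intro mult_left_mono)
    then show ?thesis
      using bound[OF e(1)] by simp
  qed
  ultimately show "dual_norm (eval_span F) (dual_norm F N) \<phi> \<le> \<alpha>"
    unfolding dual_norm_def[of "eval_span F"] by (intro cSUP_least) auto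
qed

lemma dual_space_le_dual_norm:
  assumes \<phi>: "\<phi> \<in> dual_space (eval_span F) (dual_norm F N)"
    and e: "e \<in> unit_ball (eval_span F) (dual_norm F N)"
  shows "cmod (\<phi> e) \<le> dual_norm (eval_span F) (dual_norm F N) \<phi>"
proof -
  obtain C where C: "\<And>v. v \<in> eval_span F \<Longrightarrow> cmod (\<phi> v) \<le> C * dual_norm F N v"
    using \<phi> unfolding dual_space_def by blast
  have "bdd_above ((\<lambda>v. cmod (\<phi> v)) ` unit_ball (eval_span F) (dual_norm F N))"
  proof (rule bdd_aboveI2)
    fix v assume "v \<in> unit_ball (eval_span F) (dual_norm F N)"
    then have v: "v \<in> eval_span F" "dual_norm F N v \<le> 1"
      unfolding unit_ball_def by auto
    have "C * dual_norm F N v \<le> \<bar>C\<bar> * 1"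
      using v(2) dual_norm_nonneg[OF v(1)] by (intro mult_mono) auto
    then show "cmod (\<phi> v) \<le> \<bar>C\<bar>"
      using C[OF v(1)] by simp
  qed
  then show ?thesis
    unfolding dual_norm_def[of "eval_span F"] using e by (intro cSUP_upper)
qed

lemma dual_space_bound:
  assumes \<phi>: "\<phi> \<in> dual_space (eval_span F) (dual_norm F N)" and e: "e \<in> eval_span F"
  shows "cmod (\<phi> e) \<le> dual_norm (eval_span F) (dual_norm F N) \<phi> * dual_norm F N e"
proof -
  have sub: "cfun.subspace (eval_span F)"
    unfolding eval_span_def by (rule cfun.subspace_span)
  obtain C where C: "cmod (\<phi> e) \<le> C * dual_norm F N e"
    using \<phi> e unfolding dual_space_def by blast
  show ?thesis
  proof (cases "dual_norm F N e = 0")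
    case True
    then show ?thesis
      using C by simp
  next
    case False
    define n where "n = dual_norm F N e"
    have n: "0 < n"
      using False dual_norm_nonneg[OF e] unfolding n_def by simp
    let ?v = "cscale (complex_of_real (1 / n)) e"
    have v: "?v \<in> eval_span F"
      using cfun.subspace_scale[OF sub e] .
    have "dual_norm F N ?v \<le> cmod (complex_of_real (1 / n)) * n"
      using dual_norm_cscale_le[OF e] unfolding n_def .
    also have "\<dots> = 1"
      using n by (simp del: of_real_divide)
    finally have "?v \<in> unit_ball (eval_span F) (dual_norm F N)"
      using v unfolding unit_ball_def by blast
    then have "cmod (\<phi> ?v) \<le> dual_norm (eval_span F) (dual_norm F N) \<phi>"
      by (rule dual_space_le_dual_norm[OF \<phi>])
    moreover have "\<phi> ?v = complex_of_real (1 / n) * \<phi> e"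
      using \<phi> e unfolding dual_space_def linear_map_on_def by blast
    ultimately show ?thesis
      using n unfolding n_def[symmetric]
      by (simp add: norm_mult norm_divide pos_divide_le_eq mult.commute del: of_real_divide)
  qed
qed

text \<open>Surjectivity of the pairing, with control of the norm: the polar condition for the separation argument is exactly
the bound of \<open>\<phi>\<close> by \<open>t\<close>.\<close>
lemma functional_represented:
  assumes \<phi>: "\<phi> \<in> dual_space (eval_span F) (dual_norm F N)" and t: "0 < t"
    and le: "dual_norm (eval_span F) (dual_norm F N) \<phi> \<le> t"
  defines "g \<equiv> cscale (complex_of_real (1 / t)) (\<lambda>x. \<phi> (point_eval F x))"
  shows "g \<in> closure (unit_ball F N)" "\<phi> = induced F (cscale (complex_of_real t) g)"
proof -
  have lin: "linear_map_on cscale (*) (eval_span F) \<phi>" and off: "\<And>e. e \<notin> eval_span F \<Longrightarrow> \<phi> e = 0"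
    using \<phi> unfolding dual_space_def by blast+
  obtain M where M: "\<And>h x. h \<in> closure (unit_ball F N) \<Longrightarrow> cmod (h x) \<le> M x"
    using unit_ball_bounded_at_points by blast
  show g: "g \<in> closure (unit_ball F N)"
  proof (rule bipolar_pointwise_closure)
    show "convex_funs (unit_ball F N)"
      by (rule convex_funs_unit_ball)
    show "unit_ball F N \<noteq> {}"
      using zero_in_unit_ball by blast
    show "cscale u f \<in> unit_ball F N" if "f \<in> unit_ball F N" "cmod u = 1" for f u
      using cscale_in_unit_ball that by simp
    show "cmod (f x) \<le> M x" if "f \<in> unit_ball F N" for f x
      using M[OF subsetD[OF closure_subset that]] .
    fix S :: "'a set" and c r
    assume S: "finite S" and r: "\<And>f. f \<in> unit_ball F N \<Longrightarrow> cmod (\<Sum>x\<in>S. c x * f x) \<le> r"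
    have "dual_norm F N (eval_comb F S c) \<le> r"
    proof (rule dual_norm_le)
      fix f assume f: "f \<in> unit_ball F N"
      then have "f \<in> F"
        unfolding unit_ball_def by blast
      then show "cmod (eval_comb F S c f) \<le> r"
        using r[OF f] eval_comb_apply[of f F S c] by simp
    qed
    then have "t * dual_norm F N (eval_comb F S c) \<le> t * r"
      using t by simp
    moreover have "cmod (\<phi> (eval_comb F S c)) \<le> t * dual_norm F N (eval_comb F S c)"
      using dual_space_bound[OF \<phi> eval_comb_in_span, of S c] le dual_norm_nonneg[OF eval_comb_in_span, of S c]
      by (meson mult_right_mono order_trans)
    ultimately have "cmod (\<phi> (eval_comb F S c)) \<le> t * r"
      by linarith
    moreover have "(\<Sum>x\<in>S. c x * g x) = complex_of_real (1 / t) * \<phi> (eval_comb F S c)"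
      unfolding linear_map_on_eval_comb[OF lin S] g_def cscale_def
      by (simp only: sum_distrib_left mult.left_commute)
    ultimately show "cmod (\<Sum>x\<in>S. c x * g x) \<le> r"
      using t by (simp add: norm_mult norm_divide pos_divide_le_eq mult.commute del: of_real_divide)
  qed
  have tg: "cscale (complex_of_real t) g x = \<phi> (point_eval F x)" for x
    unfolding g_def cscale_def using t by simp
  show "\<phi> = induced F (cscale (complex_of_real t) g)"
  proof
    fix e
    show "\<phi> e = induced F (cscale (complex_of_real t) g) e"
    proof (cases "e \<in> eval_span F")
      case True
      obtain S c where S: "finite S" "e = eval_comb F S c"
        using eval_span_cases[OF True] .
      show ?thesis
        unfolding S(2) induced_eval_comb[OF g S(1)] linear_map_on_eval_comb[OF lin S(1)] tg ..
    next
      case False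
      then show ?thesis
        using off unfolding induced_def by simp
    qed
  qed
qed

lemma hat_norm_le:
  assumes "0 < t" "f \<in> ball_closure F N"
  shows "hat_norm F N (cscale (complex_of_real t) f) \<le> t"
  unfolding hat_norm_def minkowski_def using assms
  by (intro cInf_lower bdd_belowI[of _ 0]) auto

lemma hat_norm_lessE:
  assumes "f \<in> hat F N" "hat_norm F N f < r"
  obtains t p where "0 < t" "t < r" "p \<in> ball_closure F N" "f = cscale (complex_of_real t) p"
proof -
  have "{t. 0 < t \<and> f \<in> cscale (complex_of_real t) ` ball_closure F N} \<noteq> {}"
    using assms(1) unfolding hat_def by blast
  from cInf_lessD[OF this] obtain t where "0 < t" "f \<in> cscale (complex_of_real t) ` ball_closure F N" "t < r"
    using assms(2) unfolding hat_norm_def minkowski_def by blast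
  then show thesis
    using that by blast
qed

lemma cscale_in_ball_closure:
  assumes f: "f \<in> ball_closure F N" and c: "cmod c \<le> 1"
  shows "cscale c f \<in> ball_closure F N"
proof -
  have "cscale c ` (compact_open closure_of unit_ball F N) \<subseteq> compact_open closure_of (cscale c ` unit_ball F N)"
    by (rule continuous_map_image_closure_subset[OF continuous_map_cscale_compact_open])
  also have "\<dots> \<subseteq> compact_open closure_of unit_ball F N"
    using cscale_in_unit_ball c by (intro closure_of_mono) blast
  finally show ?thesis
    using f unfolding ball_closure_def by blast
qed

text \<open>The infimum in the Minkowski functional need not be attained a priori, so \<open>f\<close> lies only in the multiples
\<open>t *\<close> \<open>ball_closure F N\<close> with \<open>t > 1\<close>. Letting \<open>t\<close> tend to 1 suffices because the set is closed
and bounded on compact sets.\<close>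
lemma hat_norm_le_one_imp:
  assumes f: "f \<in> hat F N" "hat_norm F N f \<le> 1"
  shows "f \<in> ball_closure F N"
proof -
  have "f \<in> compact_open closure_of (ball_closure F N)"
  proof (rule in_compact_open_closureI[OF _ ball_closure_subset_Cfuns])
    obtain \<alpha> p where "f = cscale (complex_of_real \<alpha>) p" "p \<in> ball_closure F N"
      using f(1) unfolding hat_def by blast
    then show "f \<in> Cfuns"
      using ball_closure_subset_Cfuns unfolding Cfuns_def cscale_def
      by (auto intro!: continuous_intros)
    fix K :: "'a set" and e :: real assume K: "compact K" and e: "0 < e"
    obtain M where M: "0 < M" "\<And>f x. f \<in> closure (unit_ball F N) \<Longrightarrow> x \<in> K \<Longrightarrow> cmod (f x) \<le> M"
      using unit_ball_bounded_on_compact[OF K] by blast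
    have "hat_norm F N f < 1 + e / M"
      using f(2) divide_pos_pos[OF e M(1)] by linarith
    then obtain t p where t: "0 < t" "t < 1 + e / M" "p \<in> ball_closure F N" "f = cscale (complex_of_real t) p"
      using hat_norm_lessE[OF f(1)] by blast
    \<comment> \<open>For \<open>t < 1\<close> the approximant is \<open>f\<close> itself, a member because the set is star-shaped.\<close>
    define s where "s = min t 1"
    have s: "0 < s" "s \<le> 1" "0 \<le> t - s" "t - s \<le> e / M"
      unfolding s_def using t e M(1) by (auto simp: min_def)
    have "cmod (cscale (complex_of_real s) p x - f x) \<le> e" if x: "x \<in> K" for x
    proof -
      have "cmod (p x) \<le> M"
        using M(2)[OF _ x] t(3) ball_closure_subset_closure by blast
      have "cscale (complex_of_real s) p x - f x = - (complex_of_real (t - s) * p x)"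
        unfolding t(4) cscale_def by (simp add: algebra_simps)
      then have "cmod (cscale (complex_of_real s) p x - f x) = (t - s) * cmod (p x)"
        using s(3) by (simp only: norm_minus_cancel norm_mult norm_of_real abs_of_nonneg)
      also have "\<dots> \<le> e / M * M"
        using s M(1) e \<open>cmod (p x) \<le> M\<close> by (intro mult_mono) auto
      finally show ?thesis
        using M(1) by simp
    qed
    moreover have "cscale (complex_of_real s) p \<in> ball_closure F N"
      using s t(3) by (intro cscale_in_ball_closure) auto
    ultimately show "\<exists>g\<in>ball_closure F N. \<forall>x\<in>K. cmod (g x - f x) \<le> e"
      by blast
  qed
  then show ?thesis
    unfolding ball_closure_def by simp
qed

lemma compact_closure_unit_ball: "compact (closure (unit_ball F N))"
proof -
  obtain M where M: "\<And>h x. h \<in> closure (unit_ball F N) \<Longrightarrow> cmod (h x) \<le> M x"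
    using unit_ball_bounded_at_points by blast
  have "compactin (product_topology (\<lambda>_ :: 'a. euclidean) UNIV) (PiE UNIV (\<lambda>x. cball (0 :: complex) (M x)))"
    unfolding compactin_PiE by simp
  then have "compact (PiE UNIV (\<lambda>x. cball (0 :: complex) (M x)))"
    unfolding euclidean_product_topology compactin_euclidean_iff .
  moreover have "closure (unit_ball F N) \<subseteq> PiE UNIV (\<lambda>x. cball 0 (M x))"
    using M by (auto simp: PiE_def)
  ultimately show ?thesis
    using compact_Int_closed[OF _ closed_closure] by (metis inf.absorb2)
qed

lemma hat_element:
  assumes "f \<in> hat F N"
  obtains \<alpha> p where "0 < \<alpha>" "p \<in> ball_closure F N" "f = cscale (complex_of_real \<alpha>) p"
    "p \<in> closure (unit_ball F N)"
  using assms ball_closure_subset_closure unfolding hat_def by blast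

lemma induced_on_hat:
  assumes "f \<in> hat F N"
  shows "induced F f (point_eval F x) = f x"
  using assms induced_point_eval by (metis hat_element)

text \<open>A functional of norm at most \<open>t\<close> comes from \<open>t\<close> times a member of the pointwise closure, which here equals
\<open>ball_closure F N\<close>. This gives surjectivity, and together with injectivity the inequality that the norm of
\<open>f\<close> is at most that of its functional.\<close>
lemma isometric_isomorphism_induced:
  assumes A: "compact (ball_closure F N)"
  shows "isometric_isomorphism (hat F N) (hat_norm F N)
    (dual_space (eval_span F) (dual_norm F N)) (dual_norm (eval_span F) (dual_norm F N)) (induced F)"
    (is "isometric_isomorphism _ _ ?D ?N _")
proof -
  note A_eq = ball_closure_eq_closure[OF A]
  have inj: "inj_on (induced F) (hat F N)"
  proof (rule inj_onI)
    fix f g assume "f \<in> hat F N" "g \<in> hat F N" "induced F f = induced F g"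
    then show "f = g"
      using induced_on_hat by (metis ext)
  qed
  have preimage: "\<exists>p\<in>ball_closure F N. \<phi> = induced F (cscale (complex_of_real t) p)"
    if "\<phi> \<in> ?D" "0 < t" "?N \<phi> \<le> t" for \<phi> t
    using functional_represented[OF that] unfolding A_eq by blast
  have in_hat: "cscale (complex_of_real t) p \<in> hat F N" if "p \<in> ball_closure F N" "0 < t" for t p
    using that unfolding hat_def by blast
  have into: "induced F f \<in> ?D" if "f \<in> hat F N" for f
    using hat_element[OF that] induced_in_dual_space(1) by (metis less_imp_le)
  have "\<phi> \<in> induced F ` hat F N" if \<phi>: "\<phi> \<in> ?D" for \<phi>
  proof -
    have "0 < max 1 (?N \<phi>)" "?N \<phi> \<le> max 1 (?N \<phi>)"
      by auto
    then show ?thesis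
      using preimage[OF \<phi>] in_hat by blast
  qed
  then have bij: "bij_betw (induced F) (hat F N) ?D"
    unfolding bij_betw_def using inj into by blast
  have "?N (induced F f) = hat_norm F N f" if f: "f \<in> hat F N" for f
  proof (rule antisym)
    show "?N (induced F f) \<le> hat_norm F N f"
    proof (rule dense_ge)
      fix r assume "hat_norm F N f < r"
      from hat_norm_lessE[OF f this] obtain t p
        where t: "0 < t" "t < r" "p \<in> ball_closure F N" "f = cscale (complex_of_real t) p" .
      then have "?N (induced F f) \<le> t"
        using induced_in_dual_space(2)[of p t] ball_closure_subset_closure by auto
      then show "?N (induced F f) \<le> r"
        using t(2) by simp
    qed
    have nonneg: "0 \<le> ?N (induced F f)"
    proof -
      have "0 \<in> unit_ball (eval_span F) (dual_norm F N)"
        unfolding unit_ball_def eval_span_def using cfun.span_zero dual_norm_zero by simp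
      from dual_space_le_dual_norm[OF into[OF f] this] show ?thesis
        using norm_ge_zero order_trans by blast
    qed
    show "hat_norm F N f \<le> ?N (induced F f)"
    proof (rule dense_ge)
      fix t assume "?N (induced F f) < t"
      with nonneg have t: "0 < t" "?N (induced F f) \<le> t"
        by auto
      obtain p where p: "p \<in> ball_closure F N" "induced F f = induced F (cscale (complex_of_real t) p)"
        using preimage[OF into[OF f] t] by blast
      then have "f = cscale (complex_of_real t) p"
        using inj_onD[OF inj] f in_hat t(1) by blast
      then show "hat_norm F N f \<le> t"
        using hat_norm_le[OF t(1) p(1)] by simp
    qed
  qed
  then show ?thesis
    unfolding isometric_isomorphism_def using linear_map_on_induced bij by blast
qed

text \<open>Each \<open>g\<close> in the pointwise closure of the unit ball induces a functional of norm at most 1. Its preimage under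
\<open>T\<close> has the values of \<open>g\<close> and norm at most 1, so \<open>g\<close> lies in \<open>ball_closure F N\<close>.\<close>
lemma isometric_isomorphism_imp_compact:
  assumes T: "\<And>f x. f \<in> hat F N \<Longrightarrow> T f (point_eval F x) = f x"
    and iso: "isometric_isomorphism (hat F N) (hat_norm F N)
      (dual_space (eval_span F) (dual_norm F N)) (dual_norm (eval_span F) (dual_norm F N)) T"
  shows "compact (ball_closure F N)"
proof -
  have "closure (unit_ball F N) \<subseteq> ball_closure F N"
  proof
    fix g assume g: "g \<in> closure (unit_ball F N)"
    have g1: "g = cscale (complex_of_real 1) g"
      by simp
    let ?\<phi> = "induced F (cscale (complex_of_real 1) g)"
    obtain f where f: "f \<in> hat F N" "T f = ?\<phi>"
      using induced_in_dual_space(1)[OF g, of 1] iso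
      unfolding isometric_isomorphism_def bij_betw_def by (metis imageE zero_le_one)
    have "f x = g x" for x
      using T[OF f(1), of x] induced_point_eval[OF g, of "complex_of_real 1" x] f(2) by simp
    then have "f = g"
      by blast
    moreover have "hat_norm F N f \<le> 1"
      using iso f induced_in_dual_space(2)[OF g, of 1] unfolding isometric_isomorphism_def by fastforce
    ultimately show "g \<in> ball_closure F N"
      using hat_norm_le_one_imp f(1) by blast
  qed
  then have "ball_closure F N = closure (unit_ball F N)"
    using ball_closure_subset_closure by blast
  then show ?thesis
    using compact_closure_unit_ball by simp
qed

end

section \<open>The equivalence\<close>

theorem theorem2p3:
  fixes F :: "('a::t2_space \<Rightarrow> complex) set" and N :: "('a \<Rightarrow> complex) \<Rightarrow> real"
  assumes "nscf F N"
  shows "(weakly_compactly_embedded F N \<longleftrightarrow> compactin pointwise (ball_closure F N)) \<and>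
    (compactin pointwise (ball_closure F N) \<longleftrightarrow>
      (\<exists>T. (\<forall>f\<in>hat F N. \<forall>x. T f (point_eval F x) = f x) \<and>
           isometric_isomorphism
             (hat F N) (hat_norm F N)
             (dual_space (eval_span F) (dual_norm F N))
             (dual_norm (eval_span F) (dual_norm F N)) T))"
proof -
  have "compactin pointwise (ball_closure F N) \<longleftrightarrow> compact (ball_closure F N)"
    unfolding compactin_pointwise_iff using ball_closure_subset_Cfuns[OF assms] by simp
  then show ?thesis
    using weakly_compactly_embedded_iff[OF assms] isometric_isomorphism_induced[OF assms]
      isometric_isomorphism_imp_compact[OF assms] induced_on_hat[OF assms] by blast
qed

end
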